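(* Let $\lambda\in\mathbb{R}$ and let $\gamma_\xi$, $\xi>0$, be the standard representative of an equivalence class of B-strings with multiplier $\lambda$ and characteristic number $q=m/n$. Then: 1. The trajectory of $\gamma_\xi$ is invariant under the group generated by the rotation of angle $2\pi/n$ around the $Ox$-axis, and it is contained in a region of the upper hemisphere $\mathbb{S}^2_+=\{(x,y,z)\in\mathbb{S}^2: x>0\}$ bounded by two horizontal planes (planes of the form $x=\text{const}$). 2. If $4\lambda\xi+1\neq0$, then $\gamma_\xi$ does not intersect the $Ox$-axis. Moreover: (a) if $4\lambda\xi+1>0$, then $n-m$ is the linking number of $\gamma_\xi$ with the $Ox$-axis (equipped with the upward orientation) and $\gamma_\xi$ possesses exactly $n(n-m-1)$ ordinary double points; (b) if $4\lambda\xi+1<0$, then $-m$ is the linking number of $\gamma_\xi$ with the $Ox$-axis (equipped with the upward orientation) and $\gamma_\xi$ possesses at least $nm$ points of self-intersection. 3. If $4\lambda\xi+1=0$ (necessarily $\lambda<0$), then $\gamma_\xi$ intersects the $Ox$-axis $n$ times (per period) and the moving point $\gamma_\xi(s)$ travels counter-clockwise around the $Ox$-axis (equipped with the upward orientation). In this case $n-m$ is the turning number of the plane projection of $\gamma_\xi$ into the plane $x=0$.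
   Context: $\mathbb{S}^2\subset\mathbb{R}^3$ is the unit sphere, with coordinates $(x,y,z)$. For an arc-length parameterized curve $\gamma$ in $\mathbb{S}^2$ the signed geodesic curvature $\kappa$ is defined by $\nabla_TT=\kappa N$, $T=\dot\gamma$, $N=\gamma\times\dot\gamma$. A B-curve with multiplier $\lambda$ is an arc-length parameterized curve $\gamma:\mathbb{R}\to\mathbb{S}^2$ with positive, non-constant, periodic curvature $\kappa$ such that $\mu=\sqrt{\kappa}$ satisfies, for some constant $\xi>0$, $$\dot\mu^2=-\mu^2Q(\mu),\qquad Q(t)=t^4+4\lambda t^3+4(\lambda^2-\xi^2)t^2+1.\qquad( * )$$ A B-string is a periodic B-curve. Two B-curves are equivalent if $\widetilde\gamma(s)=A\gamma(s+a)$ with $A\in SO(3)$, $a\in\mathbb{R}$. Let $\eta_\lambda$ be the unique positive root of $t^4+2\lambda t^3-1$ and $\widehat\eta_\lambda=\frac{1}{2\eta_\lambda}\sqrt{1+(\eta_\lambda(\eta_\lambda+2\lambda))^2}$. For $\xi>\widehat\eta_\lambda$, $Q$ has exactly two positive roots $e_1>e_2>0$, and $( * )$ has a non-constant positive periodic smooth solution $\mu$ on $\mathbb{R}$, with least period $\omega$, minimum $e_2$ and maximum $e_1$, unique up to translation; normalize it by $\mu(\omega/2)=e_1$. Set $$\theta(s)=2\xi\int_{\omega/2}^s\frac{\mu^2(\mu+2\lambda)}{1-4\xi^2\mu^2}\,dt,\qquad \gamma_\xi(s)=\frac{1}{2\xi\mu}\left(1,-\sigma\sqrt{4\xi^2\mu^2-1}\cos\theta,\sigma\sqrt{4\xi^2\mu^2-1}\sin\theta\right),$$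 where $\sigma\equiv1$ if $4\lambda\xi+1\ne0$, and if $4\lambda\xi+1=0$ then $\sigma=1$ on $[2k\omega,(2k+1)\omega)$ and $\sigma=-1$ on $[(2k+1)\omega,(2k+2)\omega)$, $k\in\mathbb{Z}$ (in this case the integrand is extended by continuity across its removable singularities). The curves $\gamma_\xi$, $\xi>\widehat\eta_\lambda$, are the standard representatives: every equivalence class of B-curves with multiplier $\lambda$ contains exactly one of them. Put $\Psi_\lambda(\xi)=\theta(\omega)-\theta(0)$, and let $\widehat\Psi_\lambda(\xi)$ be $\Psi_\lambda(\xi)+2\pi$ if $4\lambda\xi+1>0$, $\Psi_\lambda(\xi)+\pi$ if $4\lambda\xi+1=0$, and $\Psi_\lambda(\xi)$ if $4\lambda\xi+1<0$. The curve $\gamma_\xi$ is a B-string iff $\widehat\Psi_\lambda(\xi)=2\pi q$ with $q\in\mathbb{Q}$; the number $q=m/n$, with $m<n$ relatively prime natural numbers, is its characteristic number. The upward orientation of the $Ox$-axis is that of $(1,0,0)$. The linking number of $\gamma_\xi$ with the $Ox$-axis is the winding number around the origin of one period of its projection $(y,z)$ to the plane $x=0$, oriented by $(y,z)$. "Counter-clockwise" means $y\dot z-z\dot y>0$ away from the axis; the turning number of a closed regular plane curve is the degree of its unit tangent map over one least period, positive for counter-clockwise rotation in the $(y,z)$-plane. Points of self-intersection and double points are counted as points of the image over one period. *)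

theory Defs
  imports "HOL-Complex_Analysis.Complex_Analysis"
begin

unbundle cross3_syntax

text \<open>
  Points of the space are of type \<^typ>\<open>real^3\<close>; the coordinates \<open>x\<close>, \<open>y\<close>, \<open>z\<close> of \<open>p\<close> are
  \<open>p$1\<close>, \<open>p$2\<close>, \<open>p$3\<close>. The symbol \<open>\<times>\<close> is the cross product.
\<close>

subsection \<open>Periods and smoothness\<close>

definition has_period :: "(real \<Rightarrow> 'a) \<Rightarrow> real \<Rightarrow> bool" where
  "has_period f T \<longleftrightarrow> T > 0 \<and> (\<forall>s. f (s + T) = f s)"

definition is_least_period :: "(real \<Rightarrow> 'a) \<Rightarrow> real \<Rightarrow> bool" where
  "is_least_period f T \<longleftrightarrow> has_period f T \<and> (\<forall>T'. has_period f T' \<longrightarrow> T \<le> T')"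

definition least_period :: "(real \<Rightarrow> 'a) \<Rightarrow> real" where
  "least_period f = (THE T. is_least_period f T)"

definition velocity :: "(real \<Rightarrow> 'a::real_normed_vector) \<Rightarrow> real \<Rightarrow> 'a" where
  "velocity f s = vector_derivative f (at s)"

definition smooth :: "(real \<Rightarrow> 'a::real_normed_vector) \<Rightarrow> bool" where
  "smooth f \<longleftrightarrow> (\<forall>k s. (velocity ^^ k) f differentiable (at s))"

subsection \<open>Curves in the sphere and B-curves\<close>

definition arclength_curve :: "(real \<Rightarrow> real^3) \<Rightarrow> bool" where
  "arclength_curve \<gamma> \<longleftrightarrow> smooth \<gamma> \<and> (\<forall>s. \<gamma> s \<in> sphere 0 1 \<and> norm (velocity \<gamma> s) = 1)"

text \<open>
  The covariant derivative of the unit tangent along \<open>\<gamma>\<close> is the component of the second derivative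
  tangent to the unit sphere at \<open>\<gamma> s\<close>.
\<close>

definition cov_accel :: "(real \<Rightarrow> real^3) \<Rightarrow> real \<Rightarrow> real^3" where
  "cov_accel \<gamma> s = velocity (velocity \<gamma>) s - (velocity (velocity \<gamma>) s \<bullet> \<gamma> s) *\<^sub>R \<gamma> s"

definition geodesic_curvature :: "(real \<Rightarrow> real^3) \<Rightarrow> real \<Rightarrow> real" where
  "geodesic_curvature \<gamma> s = (THE k. cov_accel \<gamma> s = k *\<^sub>R (\<gamma> s \<times> velocity \<gamma> s))"

definition Q :: "real \<Rightarrow> real \<Rightarrow> real \<Rightarrow> real" where
  "Q lam \<xi> t = t^4 + 4 * lam * t^3 + 4 * (lam^2 - \<xi>^2) * t^2 + 1"

definition solves_ode :: "real \<Rightarrow> real \<Rightarrow> (real \<Rightarrow> real) \<Rightarrow> bool" where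
  "solves_ode lam \<xi> \<mu> \<longleftrightarrow> (\<forall>s. (velocity \<mu> s)^2 = - ((\<mu> s)^2 * Q lam \<xi> (\<mu> s)))"

definition B_curve :: "real \<Rightarrow> (real \<Rightarrow> real^3) \<Rightarrow> bool" where
  "B_curve lam \<gamma> \<longleftrightarrow> arclength_curve \<gamma> \<and>
     (\<forall>s. geodesic_curvature \<gamma> s > 0) \<and>
     \<not> geodesic_curvature \<gamma> constant_on UNIV \<and>
     (\<exists>P. has_period (geodesic_curvature \<gamma>) P) \<and>
     (\<exists>\<xi>>0. solves_ode lam \<xi> (\<lambda>s. sqrt (geodesic_curvature \<gamma> s)))"

definition B_string :: "real \<Rightarrow> (real \<Rightarrow> real^3) \<Rightarrow> bool" where
  "B_string lam \<gamma> \<longleftrightarrow> B_curve lam \<gamma> \<and> (\<exists>T. has_period \<gamma> T)"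

subsection \<open>Standard representatives\<close>

definition eta :: "real \<Rightarrow> real" where
  "eta lam = (THE t. t > 0 \<and> t^4 + 2 * lam * t^3 - 1 = 0)"

definition eta_hat :: "real \<Rightarrow> real" where
  "eta_hat lam = 1 / (2 * eta lam) * sqrt (1 + (eta lam * (eta lam + 2 * lam))^2)"

definition e1 :: "real \<Rightarrow> real \<Rightarrow> real" where
  "e1 lam \<xi> = Max {t. t > 0 \<and> Q lam \<xi> t = 0}"

text \<open>
  Smoothness matters here: the first-order equation alone also has \<open>C\<^sup>1\<close> solutions that rest at a
  root of \<open>Q\<close> for a while. For \<open>\<xi> > eta_hat lam\<close> the predicate determines \<open>\<mu>\<close> and \<open>\<omega>\<close> uniquely.
\<close>

definition normalized_solution :: "real \<Rightarrow> real \<Rightarrow> (real \<Rightarrow> real) \<Rightarrow> real \<Rightarrow> bool" where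
  "normalized_solution lam \<xi> \<mu> \<omega> \<longleftrightarrow>
     smooth \<mu> \<and> (\<forall>s. \<mu> s > 0) \<and> \<not> \<mu> constant_on UNIV \<and>
     solves_ode lam \<xi> \<mu> \<and> is_least_period \<mu> \<omega> \<and> \<mu> (\<omega> / 2) = e1 lam \<xi>"

text \<open>
  If \<open>4l\<xi> + 1 = 0\<close>, numerator and denominator of the integrand both vanish at the multiples of
  \<open>\<omega>\<close>. These singularities are removable and form a null set, so the integral is that of the
  continuous extension, whatever value \<open>0/0\<close> has.
\<close>

definition theta :: "real \<Rightarrow> real \<Rightarrow> (real \<Rightarrow> real) \<Rightarrow> real \<Rightarrow> real \<Rightarrow> real" where
  "theta lam \<xi> \<mu> \<omega> s = 2 * \<xi> *
     (LBINT t=ereal (\<omega> / 2)..ereal s. (\<mu> t)^2 * (\<mu> t + 2 * lam) / (1 - 4 * \<xi>^2 * (\<mu> t)^2))"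

definition sigma :: "real \<Rightarrow> real \<Rightarrow> real \<Rightarrow> real \<Rightarrow> real" where
  "sigma lam \<xi> \<omega> s =
     (if 4 * lam * \<xi> + 1 \<noteq> 0 \<or> even \<lfloor>s / \<omega>\<rfloor> then 1 else -1)"

definition std_curve :: "real \<Rightarrow> real \<Rightarrow> (real \<Rightarrow> real) \<Rightarrow> real \<Rightarrow> real \<Rightarrow> real^3" where
  "std_curve lam \<xi> \<mu> \<omega> s =
     (1 / (2 * \<xi> * \<mu> s)) *\<^sub>R vector
       [1,
        - sigma lam \<xi> \<omega> s * sqrt (4 * \<xi>^2 * (\<mu> s)^2 - 1) * cos (theta lam \<xi> \<mu> \<omega> s),
        sigma lam \<xi> \<omega> s * sqrt (4 * \<xi>^2 * (\<mu> s)^2 - 1) * sin (theta lam \<xi> \<mu> \<omega> s)]"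

definition Psi :: "real \<Rightarrow> real \<Rightarrow> (real \<Rightarrow> real) \<Rightarrow> real \<Rightarrow> real" where
  "Psi lam \<xi> \<mu> \<omega> = theta lam \<xi> \<mu> \<omega> \<omega> - theta lam \<xi> \<mu> \<omega> 0"

definition Psi_hat :: "real \<Rightarrow> real \<Rightarrow> (real \<Rightarrow> real) \<Rightarrow> real \<Rightarrow> real" where
  "Psi_hat lam \<xi> \<mu> \<omega> =
     (if 4 * lam * \<xi> + 1 > 0 then Psi lam \<xi> \<mu> \<omega> + 2 * pi
      else if 4 * lam * \<xi> + 1 = 0 then Psi lam \<xi> \<mu> \<omega> + pi
      else Psi lam \<xi> \<mu> \<omega>)"

definition characteristic_number ::
  "real \<Rightarrow> real \<Rightarrow> (real \<Rightarrow> real) \<Rightarrow> real \<Rightarrow> nat \<Rightarrow> nat \<Rightarrow> bool" where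
  "characteristic_number lam \<xi> \<mu> \<omega> m n \<longleftrightarrow>
     m < n \<and> coprime m n \<and> Psi_hat lam \<xi> \<mu> \<omega> = 2 * pi * (real m / real n)"

subsection \<open>Geometry relative to the Ox-axis\<close>

definition Ox_axis :: "(real^3) set" where
  "Ox_axis = {p. p$2 = 0 \<and> p$3 = 0}"

definition upper_hemisphere :: "(real^3) set" where
  "upper_hemisphere = {p \<in> sphere 0 1. p$1 > 0}"

definition rot_Ox :: "real \<Rightarrow> real^3^3" where
  "rot_Ox a = vector [vector [1, 0, 0], vector [0, cos a, - sin a], vector [0, sin a, cos a]]"

inductive_set generated_group :: "(real^3^3) set \<Rightarrow> (real^3^3) set" for S where
  "mat 1 \<in> generated_group S"
| "A \<in> S \<Longrightarrow> A \<in> generated_group S"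
| "A \<in> generated_group S \<Longrightarrow> matrix_inv A \<in> generated_group S"
| "A \<in> generated_group S \<Longrightarrow> B \<in> generated_group S \<Longrightarrow> A ** B \<in> generated_group S"

text \<open>The plane \<open>x = 0\<close> is identified with the complex plane, with the orientation given by \<open>(y, z)\<close>.\<close>

definition proj_yz :: "real^3 \<Rightarrow> complex" where
  "proj_yz p = Complex (p$2) (p$3)"

definition linking_number_Ox :: "(real \<Rightarrow> real^3) \<Rightarrow> complex" where
  "linking_number_Ox \<gamma> = winding_number (\<lambda>t. proj_yz (\<gamma> (least_period \<gamma> * t))) 0"

text \<open>The degree of the unit tangent map, as a loop in the unit circle, is its winding number around 0.\<close>

definition turning_number :: "(real \<Rightarrow> complex) \<Rightarrow> complex" where
  "turning_number c = winding_number (\<lambda>t. sgn (velocity c (least_period c * t))) 0"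

subsection \<open>Multiple points of a periodic curve\<close>

definition self_intersection_points :: "(real \<Rightarrow> real^3) \<Rightarrow> (real^3) set" where
  "self_intersection_points \<gamma> =
     {p. \<exists>s\<in>{0..<least_period \<gamma>}. \<exists>t\<in>{0..<least_period \<gamma>}. s \<noteq> t \<and> \<gamma> s = p \<and> \<gamma> t = p}"

text \<open>Ordinary double point: exactly two branches, crossing transversally.\<close>

definition ordinary_double_points :: "(real \<Rightarrow> real^3) \<Rightarrow> (real^3) set" where
  "ordinary_double_points \<gamma> =
     {p. \<exists>s t. s \<noteq> t \<and> {u \<in> {0..<least_period \<gamma>}. \<gamma> u = p} = {s, t} \<and>
         \<not> collinear {0, velocity \<gamma> s, velocity \<gamma> t}}"

end

theory Submission
  imports Defs
begin

text \<open>
  Differentiating the first-order equation shows that \<open>\<mu>\<close> solves a second-order equation with unique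
  solutions, so \<open>\<mu>\<close> is symmetric about each of its critical points; these are exactly the multiples of
  \<open>\<omega>/2\<close>, and \<open>\<mu>\<close> increases strictly on \<open>[0, \<omega>/2]\<close>. Identify the \<open>(y, z)\<close>-plane with the complex
  numbers. The projection of the curve is, up to a constant phase, \<open>\<rho> e\<^sup>i\<^sup>\<phi>\<close> with \<open>\<phi> = \<theta>(0) - \<theta>\<close> odd and
  \<open>\<rho>\<^sup>2\<close> an injective function of \<open>\<mu>\<close>, and \<open>s \<mapsto> s + \<omega>\<close> rotates the curve by the angle \<open>- 2\<pi>m/n\<close>. Hence
  its least period is \<open>n\<omega>\<close>, and, unless \<open>4l\<xi> + 1 = 0\<close>, two parameters with the same
  image either differ by a multiple of \<open>n\<omega>\<close> or are of the form \<open>s + i\<omega>\<close> and \<open>k\<omega> - s\<close> with \<open>\<phi>(s)\<close> a multiple of \<open>\<pi>/n\<close>. If \<open>4l\<xi> + 1 > 0\<close>, the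
  angle \<open>\<phi>\<close> increases strictly and such \<open>s\<close> can be counted in \<open>(0, \<omega>/2)\<close>; if \<open>4l\<xi> + 1 < 0\<close>, the
  intermediate value theorem still provides \<open>m\<close> of them, the last one because \<open>\<phi>\<close> approaches
  \<open>\<phi>(\<omega>/2) = - \<pi>m/n\<close> from below. If \<open>4l\<xi> + 1 = 0\<close>, the velocity in the frame rotating with \<open>\<phi>\<close> turns
  through the upper half plane by \<open>\<pi>\<close> per period of \<open>\<mu>\<close>, which gives the turning number.
\<close>

subsection \<open>Periods and second-order equations\<close>

text \<open>Gronwall's argument: the squared distance \<open>E\<close> of the phase points satisfies
  \<open>\<bar>E'\<bar> \<le> C * E\<close>, so comparison with \<open>exp (- C * s)\<close> makes
  it vanish to the right of \<open>a\<close>, and comparison with \<open>exp (C * s)\<close> to the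
  left. The Lipschitz bound is asked for only along the two solutions, because the polynomial to
  which this is applied has no global one.\<close>

lemma second_order_ode_unique:
  fixes u v u' v' f :: "real \<Rightarrow> real"
  assumes u: "\<And>s. (u has_real_derivative u' s) (at s)"
      "\<And>s. (u' has_real_derivative f (u s)) (at s)"
    and v: "\<And>s. (v has_real_derivative v' s) (at s)"
      "\<And>s. (v' has_real_derivative f (v s)) (at s)"
    and lip: "\<And>s. \<bar>f (u s) - f (v s)\<bar> \<le> K * \<bar>u s - v s\<bar>"
    and init: "u a = v a" "u' a = v' a"
  shows "u s = v s"
proof -
  define C where "C = 1 + \<bar>K\<bar>"
  define E where "E s = (u s - v s)^2 + (u' s - v' s)^2" for s
  define E' where "E' s = 2 * (u s - v s) * (u' s - v' s)
    + 2 * (u' s - v' s) * (f (u s) - f (v s))" for s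
  have dE: "(E has_real_derivative E' s) (at s)" for s
    unfolding E_def E'_def
    by (rule u v derivative_eq_intros refl | simp add: algebra_simps)+
  have bound: "\<bar>E' s\<bar> \<le> C * E s" for s
  proof -
    have "\<bar>E' s\<bar> \<le> 2 * \<bar>u s - v s\<bar> * \<bar>u' s - v' s\<bar> + 2 * \<bar>u' s - v' s\<bar> * \<bar>f (u s) - f (v s)\<bar>"
      unfolding E'_def by (rule order_trans[OF abs_triangle_ineq]) (simp only: abs_mult abs_numeral order.refl)
    also have "\<dots> \<le> 2 * \<bar>u s - v s\<bar> * \<bar>u' s - v' s\<bar>
        + 2 * \<bar>u' s - v' s\<bar> * (\<bar>K\<bar> * \<bar>u s - v s\<bar>)"
      using lip[of s] by (intro add_left_mono mult_left_mono order_trans[OF lip] mult_right_mono) auto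
    also have "\<dots> = C * (2 * \<bar>u s - v s\<bar> * \<bar>u' s - v' s\<bar>)"
      by (simp add: C_def algebra_simps)
    also have "\<dots> \<le> C * E s"
      using sum_squares_bound[of "\<bar>u s - v s\<bar>" "\<bar>u' s - v' s\<bar>"]
      by (intro mult_left_mono) (auto simp: E_def C_def)
    finally show ?thesis .
  qed
  have "E s \<le> 0"
  proof (cases "a \<le> s")
    case True
    have "E s * exp (- C * s) \<le> E a * exp (- C * a)"
    proof (rule DERIV_nonpos_imp_nonincreasing[OF True])
      fix x
      have "((\<lambda>s. E s * exp (- C * s)) has_real_derivative (E' x - C * E x) * exp (- C * x)) (at x)"
        by (rule dE derivative_eq_intros refl | simp add: algebra_simps)+
      moreover have "(E' x - C * E x) * exp (- C * x) \<le> 0"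
        using bound[of x] by (intro mult_nonpos_nonneg) auto
      ultimately show "\<exists>y. ((\<lambda>s. E s * exp (- C * s)) has_real_derivative y) (at x) \<and> y \<le> 0"
        by blast
    qed
    also have "E a * exp (- C * a) = 0"
      by (simp add: E_def init)
    finally show ?thesis by (simp add: mult_le_0_iff)
  next
    case False
    have "E s * exp (C * s) \<le> E a * exp (C * a)"
    proof (rule DERIV_nonneg_imp_nondecreasing[where f = "\<lambda>s. E s * exp (C * s)"])
      show "s \<le> a" using False by simp
      fix x
      have "((\<lambda>s. E s * exp (C * s)) has_real_derivative (E' x + C * E x) * exp (C * x)) (at x)"
        by (rule dE derivative_eq_intros refl | simp add: algebra_simps)+
      moreover have "(E' x + C * E x) * exp (C * x) \<ge> 0"
        using bound[of x] by (intro mult_nonneg_nonneg) auto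
      ultimately show "\<exists>y. ((\<lambda>s. E s * exp (C * s)) has_real_derivative y) (at x) \<and> y \<ge> 0"
        by blast
    qed
    also have "E a * exp (C * a) = 0"
      by (simp add: E_def init)
    finally show ?thesis by (simp add: mult_le_0_iff)
  qed
  moreover have "E s \<ge> 0" by (simp add: E_def)
  ultimately have "(u s - v s)^2 = 0"
    using zero_le_power2[of "u s - v s"] zero_le_power2[of "u' s - v' s"] unfolding E_def by linarith
  then show ?thesis by simp
qed

lemma has_period_int:
  assumes "has_period f T"
  shows "f (s + of_int k * T) = f s"
proof -
  have nat: "f (s + of_nat j * T) = f s" for s j
  proof (induction j)
    case (Suc j)
    have "s + of_nat (Suc j) * T = (s + of_nat j * T) + T" by (simp add: algebra_simps)
    then show ?case using assms Suc unfolding has_period_def by metis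
  qed simp
  show ?thesis
  proof (cases k)
    case (nonneg j) then show ?thesis using nat by simp
  next
    case (neg j)
    have "s + of_int k * T + of_nat (Suc j) * T = s" unfolding neg by (simp add: algebra_simps)
    then show ?thesis using nat by metis
  qed
qed

text \<open>The remainder of \<open>T\<close> modulo \<open>w\<close> also leaves \<open>f\<close>
  invariant, so unless it is 0 it would be a period smaller than \<open>w\<close>.\<close>

lemma least_period_divides:
  assumes "is_least_period f w" "has_period f T"
  obtains k :: nat where "k > 0" "T = of_nat k * w"
proof -
  have w: "w > 0" and T: "T > 0" and per: "has_period f w"
    using assms by (auto simp: is_least_period_def has_period_def)
  define k where "k = \<lfloor>T / w\<rfloor>"
  define R where "R = T - of_int k * w"
  have "R \<ge> 0" "R < w"
    using w floor_divide_lower[of w T] floor_divide_upper[of w T]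
    by (auto simp: R_def k_def algebra_simps)
  have "f (s + R) = f s" for s
  proof -
    have "f (s + R) = f (s + T + of_int (- k) * w)" by (simp add: R_def algebra_simps)
    also have "\<dots> = f (s + T)" by (rule has_period_int[OF per])
    also have "\<dots> = f s" using assms(2) by (simp add: has_period_def)
    finally show ?thesis .
  qed
  have "R = 0"
  proof (rule ccontr)
    assume "R \<noteq> 0"
    then have "has_period f R" using \<open>R \<ge> 0\<close> \<open>\<And>s. f (s + R) = f s\<close> by (simp add: has_period_def)
    then show False using assms(1) \<open>R < w\<close> by (auto simp: is_least_period_def)
  qed
  then have Tk: "T = of_int k * w" by (simp add: R_def)
  then have "k > 0" using T w by (simp add: zero_less_mult_iff)
  then show ?thesis using Tk by (intro that[of "nat k"]) auto
qed

lemma least_period_eqI: "is_least_period f w \<Longrightarrow> least_period f = w"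
  unfolding least_period_def by (rule the_equality) (auto simp: is_least_period_def intro: antisym)

section \<open>Roots of the quartic \<open>Q\<close>\<close>

lemma Q_eq: "Q lam \<xi> t = t^2 * (t + 2 * lam)^2 + 1 - 4 * \<xi>^2 * t^2"
  by (simp add: Q_def algebra_simps power2_eq_square power4_eq_xxxx power3_eq_cube)

text \<open>The equation reads \<open>t^3 * (t + 2 * lam) = 1\<close>. This forces
  \<open>t + 2 * lam > 0\<close>, and on that range the left side increases strictly.\<close>

lemma eta_unique:
  assumes "t > 0" "t^4 + 2 * lam * t^3 - 1 = 0"
  shows "eta lam = t"
  unfolding eta_def
proof (rule the_equality)
  show "t > 0 \<and> t^4 + 2 * lam * t^3 - 1 = 0" using assms by simp
  fix u assume u: "u > 0 \<and> u^4 + 2 * lam * u^3 - 1 = 0"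
  have *: False if "0 < a" "a < b" "a^3 * (a + 2 * lam) = 1" "b^3 * (b + 2 * lam) = 1" for a b :: real
  proof -
    have "a + 2 * lam > 0" using that by (metis zero_less_mult_pos zero_less_one zero_less_power)
    then have "a^3 * (a + 2 * lam) < b^3 * (b + 2 * lam)"
      using that by (intro mult_strict_mono power_strict_mono) auto
    then show False using that by simp
  qed
  have "u^3 * (u + 2 * lam) = 1" "t^3 * (t + 2 * lam) = 1"
    using u assms by (auto simp: algebra_simps power4_eq_xxxx power3_eq_cube)
  then show "u = t" using *[of u t] *[of t u] u assms(1) by (meson linorder_neqE_linordered_idom)
qed

definition Q' :: "real \<Rightarrow> real \<Rightarrow> real \<Rightarrow> real" where
  "Q' lam \<xi> t = 4 * t^3 + 12 * lam * t^2 + 8 * (lam^2 - \<xi>^2) * t"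

lemma DERIV_Q: "(Q lam \<xi> has_real_derivative Q' lam \<xi> t) (at t)"
  unfolding Q_def[abs_def] Q'_def by (auto intro!: derivative_eq_intros)

text \<open>This is where the bound by \<open>eta_hat\<close> enters. If \<open>Q\<close> and
  \<open>Q'\<close> both vanish at \<open>t\<close>, eliminating \<xi> gives the equation that
  defines \<open>eta lam\<close>, so \<open>t = eta lam\<close>; then \<open>Q = 0\<close> turns
  into \<open>\<xi> = eta_hat lam\<close>.\<close>

lemma Q_simple_root:
  assumes "\<xi> > 0" "\<xi> > eta_hat lam" "t > 0" "Q lam \<xi> t = 0"
  shows "Q' lam \<xi> t \<noteq> 0"
proof
  assume "Q' lam \<xi> t = 0"
  then have "t * (4 * t^2 + 12 * lam * t + 8 * (lam^2 - \<xi>^2)) = 0"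
    by (simp add: Q'_def algebra_simps power2_eq_square power3_eq_cube)
  then have \<xi>: "4 * (lam^2 - \<xi>^2) = - 2 * t^2 - 6 * lam * t" using assms(3) by simp
  have "t^4 + 4 * lam * t^3 + (- 2 * t^2 - 6 * lam * t) * t^2 + 1 = 0"
    using assms(4) unfolding Q_def \<xi> .
  then have "t^4 + 2 * lam * t^3 - 1 = 0"
    by (simp add: algebra_simps power2_eq_square power4_eq_xxxx power3_eq_cube)
  then have eta: "eta lam = t" using assms(3) eta_unique by blast
  have "1 + (t * (t + 2 * lam))^2 = (2 * \<xi> * t)^2"
    using assms(4) unfolding Q_eq by (simp add: power_mult_distrib)
  then have "eta_hat lam = 1 / (2 * t) * (2 * \<xi> * t)"
    using assms(1,3) unfolding eta_hat_def eta by (simp del: real_sqrt_eq_iff)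
  then show False using assms(1-3) by simp
qed

lemma finite_Q_roots: "finite {t. t > 0 \<and> Q lam \<xi> t = 0}"
proof -
  define p where "p = [:1, 0, 4 * (lam^2 - \<xi>^2), 4 * lam, 1:]"
  have "p \<noteq> 0" by (simp add: p_def)
  moreover have "poly p t = Q lam \<xi> t" for t
    by (simp add: p_def Q_def algebra_simps power2_eq_square power4_eq_xxxx power3_eq_cube)
  ultimately show ?thesis
    using poly_roots_finite[of p] by (auto elim!: finite_subset[rotated])
qed

subsection \<open>The curvature function\<close>

lemma smooth_has_vector_derivative:
  assumes "smooth f"
  shows "((velocity ^^ k) f has_vector_derivative velocity ((velocity ^^ k) f) s) (at s)"
  using assms unfolding smooth_def velocity_def by (simp add: vector_derivative_works)

lemma smooth_continuous:
  assumes "smooth f"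
  shows "continuous_on A ((velocity ^^ k) f)"
  using assms unfolding smooth_def
  by (meson continuous_at_imp_continuous_on differentiable_imp_continuous_within)

locale normalized_B_solution =
  fixes lam \<xi> \<omega> :: real and \<mu> :: "real \<Rightarrow> real"
  assumes xi_pos: "\<xi> > 0" and xi_gt: "\<xi> > eta_hat lam"
    and sol: "normalized_solution lam \<xi> \<mu> \<omega>"
begin

abbreviation "\<mu>' \<equiv> velocity \<mu>"

text \<open>Right-hand side of the second-order equation: differentiating
  \<open>\<mu>'^2 = - \<mu>^2 * Q(\<mu>)\<close> gives
  \<open>2 * \<mu>' * \<mu>'' = 2 * \<mu>' * accel(\<mu>)\<close>.\<close>

definition accel :: "real \<Rightarrow> real" where
  "accel t = - (t * Q lam \<xi> t + t^2 * Q' lam \<xi> t / 2)"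

lemma mu_pos [simp]: "\<mu> s > 0" and mu_smooth: "smooth \<mu>" and mu_nonconst: "\<not> \<mu> constant_on UNIV"
  and mu_ode: "(\<mu>' s)^2 = - ((\<mu> s)^2 * Q lam \<xi> (\<mu> s))"
  and mu_lp: "is_least_period \<mu> \<omega>" and mu_mid: "\<mu> (\<omega> / 2) = e1 lam \<xi>"
  using sol by (auto simp: normalized_solution_def solves_ode_def)

lemma mu_neq_0 [simp]: "\<mu> s \<noteq> 0" and mu_nonneg [simp]: "\<mu> s \<ge> 0"
  by (metis mu_pos less_irrefl) (metis mu_pos less_imp_le)

lemma omega_pos: "\<omega> > 0" and mu_period: "\<mu> (s + \<omega>) = \<mu> s"
  using mu_lp by (auto simp: is_least_period_def has_period_def)

lemma mu_period_int: "\<mu> (s + of_int k * \<omega>) = \<mu> s"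
  using mu_lp by (auto simp: is_least_period_def intro: has_period_int)

lemma DERIV_mu: "(\<mu> has_real_derivative \<mu>' s) (at s)"
  and DERIV_mu': "(\<mu>' has_real_derivative velocity \<mu>' s) (at s)"
  and cont_mu: "continuous_on A \<mu>" and cont_mu': "continuous_on A \<mu>'"
  and cont_mu'': "continuous_on A (velocity \<mu>')"
  using smooth_has_vector_derivative[OF mu_smooth, of 0] smooth_has_vector_derivative[OF mu_smooth, of 1]
    smooth_continuous[OF mu_smooth, of A 0] smooth_continuous[OF mu_smooth, of A 1]
    smooth_continuous[OF mu_smooth, of A 2]
  by (auto simp: has_real_derivative_iff_has_vector_derivative numeral_2_eq_2)

lemma mu'_zero_iff: "\<mu>' s = 0 \<longleftrightarrow> Q lam \<xi> (\<mu> s) = 0"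
  using mu_ode[of s] by auto

lemma Q_mu_le_0: "Q lam \<xi> (\<mu> s) \<le> 0"
proof -
  have "(\<mu> s)^2 * Q lam \<xi> (\<mu> s) \<le> 0"
    using mu_ode[of s] by (metis neg_le_0_iff_le zero_le_power2 minus_minus)
  then show ?thesis
    by (simp add: mult_le_0_iff)
qed

text \<open>The two summands on the left serve separately: the square bounds
  \<open>\<bar>\<mu> + 2 * lam\<bar>\<close> by \<open>2 * \<xi>\<close>, and the 1 bounds \<mu>
  from below.\<close>

lemma mu_ineq: "(\<mu> s)^2 * (\<mu> s + 2 * lam)^2 + 1 \<le> 4 * \<xi>^2 * (\<mu> s)^2"
  using Q_mu_le_0[of s] by (simp add: Q_eq)

lemma mu_bound: "\<mu> s \<le> 2 * \<xi> + 2 * \<bar>lam\<bar>"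
proof -
  have "(\<mu> s)^2 * (\<mu> s + 2 * lam)^2 \<le> (\<mu> s)^2 * (2 * \<xi>)^2"
  proof -
    have "(\<mu> s)^2 * (2 * \<xi>)^2 = 4 * \<xi>^2 * (\<mu> s)^2" by (simp add: power_mult_distrib)
    then show ?thesis using mu_ineq[of s] by linarith
  qed
  moreover have "(\<mu> s)^2 > 0" by simp
  ultimately have "(\<mu> s + 2 * lam)^2 \<le> (2 * \<xi>)^2"
    by (rule mult_left_le_imp_le)
  then have "\<mu> s + 2 * lam \<le> 2 * \<xi>"
    by (rule power2_le_imp_le) (use xi_pos in simp)
  then show ?thesis by linarith
qed

text \<open>At a root only the term with \<open>Q'\<close> survives, and it is nonzero because the
  root is simple.\<close>

lemma accel_root: "t > 0 \<Longrightarrow> Q lam \<xi> t = 0 \<Longrightarrow> accel t \<noteq> 0"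
  using Q_simple_root[OF xi_pos xi_gt] by (simp add: accel_def)

lemma cont_accel: "continuous_on A accel"
  unfolding accel_def[abs_def] Q_def Q'_def by (intro continuous_intros) auto

text \<open>
  The two closed sets below cover the line and are disjoint, because the roots of \<open>Q\<close> attained by
  \<open>\<mu>\<close> are simple: this is what excludes solutions that rest at a root for a while.
\<close>

lemma mu''_eq: "velocity \<mu>' s = accel (\<mu> s)"
proof -
  define A where "A = {s. velocity \<mu>' s = accel (\<mu> s)}"
  define B where "B = {s. \<mu>' s = 0 \<and> velocity \<mu>' s = 0}"
  have cont: "continuous_on UNIV (\<lambda>s. accel (\<mu> s))"
    by (rule continuous_on_compose2[OF cont_accel[of UNIV] cont_mu]) auto
  have A: "closed A" unfolding A_def by (intro closed_Collect_eq cont cont_mu'')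
  have B: "closed B" unfolding B_def Collect_conj_eq
    by (intro closed_Int closed_Collect_eq cont_mu' cont_mu'' continuous_on_const)
  \<comment> \<open>Where \<open>\<mu>' \<noteq> 0\<close>, the first-order equation can be
    differentiated and the factor \<open>2 * \<mu>'\<close> cancelled.\<close>
  have off: "\<mu>' s = 0" if "s \<notin> A" for s
  proof (rule ccontr)
    assume nz: "\<mu>' s \<noteq> 0"
    have 1: "((\<lambda>s. (\<mu>' s)^2) has_real_derivative 2 * \<mu>' s * velocity \<mu>' s) (at s)"
      by (rule DERIV_mu' derivative_eq_intros refl | simp)+
    have 2: "((\<lambda>s. - ((\<mu> s)^2 * Q lam \<xi> (\<mu> s))) has_real_derivative 2 * \<mu>' s * accel (\<mu> s)) (at s)"
      unfolding accel_def
      by (rule DERIV_mu DERIV_chain2[OF DERIV_Q] derivative_eq_intros refl |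
          simp add: algebra_simps power2_eq_square)+
    have "(\<lambda>s. (\<mu>' s)^2) = (\<lambda>s. - ((\<mu> s)^2 * Q lam \<xi> (\<mu> s)))"
      using mu_ode by auto
    with 1 2 have "2 * \<mu>' s * velocity \<mu>' s = 2 * \<mu>' s * accel (\<mu> s)"
      using DERIV_unique by metis
    then show False using nz that by (simp add: A_def)
  qed
  \<comment> \<open>The complement of \<open>A\<close> is open, so \<open>\<mu>'\<close> vanishes on
    a neighbourhood of such a point and its derivative vanishes there too.\<close>
  have cover: "s \<in> A \<union> B" for s
  proof (rule ccontr)
    assume s: "s \<notin> A \<union> B"
    have "eventually (\<lambda>t. t \<in> - A) (nhds s)"
      using A s by (intro eventually_nhds_in_open) auto
    then have "eventually (\<lambda>t. \<mu>' t = 0) (nhds s)"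
      by eventually_elim (use off in auto)
    then have "(\<mu>' has_real_derivative 0) (at s)"
      using DERIV_cong_ev[OF refl _ refl, of \<mu>' "\<lambda>_. 0" s 0] by simp
    then have "velocity \<mu>' s = 0" using DERIV_mu' DERIV_unique by blast
    then show False using s off by (auto simp: B_def)
  qed
  have disj: "A \<inter> B = {}"
  proof -
    have False if "s \<in> A" "s \<in> B" for s
      using that accel_root[of "\<mu> s"] mu'_zero_iff[of s] by (auto simp: A_def B_def)
    then show ?thesis by blast
  qed
  have "A = {} \<or> B = {}"
    using connected_closedD[of UNIV A B] connected_UNIV A B disj cover by auto
  \<comment> \<open>If \<open>A\<close> were empty, \<open>\<mu>'\<close> would vanish identically,
    but \<mu> is not constant.\<close>
  moreover have "A \<noteq> {}"
  proof
    assume "A = {}"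
    then have "\<mu>' s = 0" for s using cover by (auto simp: B_def)
    then have "(\<mu> has_real_derivative 0) (at s)" for s using DERIV_mu[of s] by simp
    then have "\<mu> s = \<mu> 0" for s by (intro DERIV_isconst_all) auto
    then show False using mu_nonconst by (auto simp: constant_on_def)
  qed
  ultimately show ?thesis using cover by (auto simp: A_def)
qed

text \<open>\<mu> stays in the compact interval \<open>{0..M}\<close>, where the derivative
  \<open>D\<close> of the polynomial \<open>accel\<close> is bounded.\<close>

lemma accel_lipschitz:
  "\<exists>K. \<forall>s t. \<bar>accel (\<mu> s) - accel (\<mu> t)\<bar> \<le> K * \<bar>\<mu> s - \<mu> t\<bar>"
proof -
  define M where "M = 2 * \<xi> + 2 * \<bar>lam\<bar>"
  define D where "D t = - (15 * t^4 + 40 * lam * t^3 + 24 * (lam^2 - \<xi>^2) * t^2 + 1)" for t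
  have accel: "accel = (\<lambda>t. - (3 * t^5 + 10 * lam * t^4 + 8 * (lam^2 - \<xi>^2) * t^3 + t))"
    by (rule ext) (simp add: accel_def Q_def Q'_def field_simps eval_nat_numeral)
  have d: "(accel has_real_derivative D t) (at t within S)" for t S
    unfolding accel D_def by (auto intro!: derivative_eq_intros)
  have "compact (D ` {0..M})"
    unfolding D_def[abs_def] by (intro compact_continuous_image continuous_intros) auto
  then have "bounded (D ` {0..M})" by (rule compact_imp_bounded)
  then obtain K where K: "\<And>t. t \<in> {0..M} \<Longrightarrow> norm (D t) \<le> K"
    unfolding bounded_iff by blast
  have "norm (accel (\<mu> s) - accel (\<mu> t)) \<le> K * norm (\<mu> s - \<mu> t)" for s t
    by (rule field_differentiable_bound[of "{0..M}", OF _ d K]) (auto simp: M_def mu_bound)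
  then show ?thesis by (metis real_norm_def)
qed

text \<open>The second-order equation is autonomous and invariant under time reversal, so the
  reflected function solves it too; both solutions have the same value and slope 0 at
  \<open>a\<close>.\<close>

lemma mu_reflect:
  assumes "\<mu>' a = 0"
  shows "\<mu> (2 * a - s) = \<mu> s"
proof -
  obtain K where K: "\<And>s t. \<bar>accel (\<mu> s) - accel (\<mu> t)\<bar> \<le> K * \<bar>\<mu> s - \<mu> t\<bar>"
    using accel_lipschitz by blast
  have dmu': "(\<mu>' has_real_derivative accel (\<mu> s)) (at s)" for s
    using DERIV_mu'[of s] by (simp add: mu''_eq)
  show ?thesis
  proof (rule second_order_ode_unique[where u = "\<lambda>s. \<mu> (2 * a - s)" and v = \<mu>
        and u' = "\<lambda>s. - \<mu>' (2 * a - s)" and v' = \<mu>' and f = accel and K = K and a = a])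
    show "((\<lambda>s. \<mu> (2 * a - s)) has_real_derivative - \<mu>' (2 * a - s)) (at s)" for s
      by (rule DERIV_cong[OF DERIV_chain2[OF DERIV_mu, where Db = "- 1"]])
        (auto intro!: derivative_eq_intros)
    show "((\<lambda>s. - \<mu>' (2 * a - s)) has_real_derivative accel (\<mu> (2 * a - s))) (at s)" for s
      by (rule DERIV_cong[OF DERIV_minus[OF DERIV_chain2[OF dmu', where Db = "- 1"]]])
        (auto intro!: derivative_eq_intros)
  qed (use K DERIV_mu dmu' assms in auto)
qed

section \<open>Critical points, symmetry and monotonicity of \<mu>\<close>

lemma mu_Rolle:
  assumes "a < b" "\<mu> a = \<mu> b"
  obtains z where "a < z" "z < b" "\<mu>' z = 0"
proof -
  have "\<exists>z. a < z \<and> z < b \<and> (\<mu> has_real_derivative 0) (at z)"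
    by (rule Rolle[OF assms cont_mu]) (use DERIV_mu real_differentiable_def in blast)
  then obtain z where z: "a < z" "z < b" "(\<mu> has_real_derivative 0) (at z)" by blast
  then have "\<mu>' z = 0" using DERIV_mu[of z] DERIV_unique by blast
  then show ?thesis using z that by blast
qed

lemma e1_root: "e1 lam \<xi> > 0" "Q lam \<xi> (e1 lam \<xi>) = 0"
  and e1_max: "t > 0 \<Longrightarrow> Q lam \<xi> t = 0 \<Longrightarrow> t \<le> e1 lam \<xi>"
proof -
  \<comment> \<open>The \<open>Max\<close> in \<open>e1\<close> needs a root to exist: a critical
    point of \<mu> within one period provides one.\<close>
  obtain z where "0 < z" "z < \<omega>" "\<mu>' z = 0"
    using mu_Rolle[of 0 \<omega>] omega_pos mu_period[of 0] by (metis add_0)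
  then have ne: "{t. t > 0 \<and> Q lam \<xi> t = 0} \<noteq> {}" using mu'_zero_iff[of z] mu_pos[of z] by blast
  then show "e1 lam \<xi> > 0" "Q lam \<xi> (e1 lam \<xi>) = 0"
    using Max_in[OF finite_Q_roots ne] by (auto simp: e1_def)
  show "t > 0 \<Longrightarrow> Q lam \<xi> t = 0 \<Longrightarrow> t \<le> e1 lam \<xi>"
    unfolding e1_def by (rule Max_ge[OF finite_Q_roots]) simp
qed

lemma mu'_mid: "\<mu>' (\<omega> / 2) = 0"
  using e1_root by (simp add: mu'_zero_iff mu_mid)

text \<open>Reflection in \<open>\<omega> / 2\<close> combined with a shift by the period is
  reflection in 0.\<close>

lemma mu_even: "\<mu> (- s) = \<mu> s"
  using mu_reflect[OF mu'_mid, of "s + \<omega>"] mu_period[of s] by simp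

lemma mu_reflect_int: "\<mu> (of_int k * \<omega> - s) = \<mu> s"
  using mu_period_int[of "- s" k] by (simp add: mu_even algebra_simps)

lemma mu'_odd: "\<mu>' (- s) = - \<mu>' s"
proof -
  have "((\<lambda>s. \<mu> (- s)) has_real_derivative - \<mu>' (- s)) (at s)"
    by (rule DERIV_mirror[THEN iffD1, OF DERIV_mu])
  then have "(\<mu> has_real_derivative - \<mu>' (- s)) (at s)" by (simp add: mu_even)
  then show ?thesis using DERIV_unique[OF DERIV_mu] by force
qed

lemma mu'_period_int: "\<mu>' (s + of_int k * \<omega>) = \<mu>' s"
proof -
  have "((\<lambda>s. \<mu> (s + of_int k * \<omega>)) has_real_derivative \<mu>' (s + of_int k * \<omega>)) (at s)"
    by (rule DERIV_shift[THEN iffD1, OF DERIV_mu])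
  then have "(\<mu> has_real_derivative \<mu>' (s + of_int k * \<omega>)) (at s)" by (simp add: mu_period_int)
  then show ?thesis using DERIV_unique[OF DERIV_mu] by force
qed

text \<open>Reflecting in two critical points gives a period, so these are at least \<open>\<omega>/2\<close> apart.\<close>

lemma mu'_nonzero:
  assumes "0 < s" "s < \<omega> / 2"
  shows "\<mu>' s \<noteq> 0"
proof
  assume "\<mu>' s = 0"
  have "\<mu> (t + 2 * s) = \<mu> t" for t
    using mu_reflect[OF \<open>\<mu>' s = 0\<close>, of "- t"] by (simp add: mu_even add.commute)
  then have "has_period \<mu> (2 * s)" using assms by (simp add: has_period_def)
  then show False using mu_lp assms by (auto simp: is_least_period_def)
qed

text \<open>Oddness of \<open>\<mu>'\<close> makes 0 a critical point. Equal values at 0 and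
  \<open>\<omega> / 2\<close> would by Rolle produce a further critical point between them.\<close>

lemma mu_0: "Q lam \<xi> (\<mu> 0) = 0" "\<mu> 0 < e1 lam \<xi>"
proof -
  have "\<mu>' 0 = 0" using mu'_odd[of 0] by simp
  then show Q0: "Q lam \<xi> (\<mu> 0) = 0" by (simp add: mu'_zero_iff)
  have "\<mu> 0 \<noteq> e1 lam \<xi>"
  proof
    assume "\<mu> 0 = e1 lam \<xi>"
    then obtain z where "0 < z" "z < \<omega> / 2" "\<mu>' z = 0"
      using mu_Rolle[of 0 "\<omega> / 2"] omega_pos mu_mid by (metis half_gt_zero)
    then show False using mu'_nonzero by blast
  qed
  then show "\<mu> 0 < e1 lam \<xi>" using e1_max[OF _ Q0] by simp
qed

text \<open>Having no zero on this interval, \<open>\<mu>'\<close> keeps its sign there; by the mean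
  value theorem it is positive somewhere, as \<open>\<mu> 0 < \<mu> (\<omega> / 2)\<close>.\<close>

lemma mu'_pos:
  assumes "0 < s" "s < \<omega> / 2"
  shows "\<mu>' s > 0"
proof (rule ccontr)
  assume "\<not> \<mu>' s > 0"
  then have s: "\<mu>' s < 0" using mu'_nonzero[OF assms] by simp
  obtain z where z: "0 < z" "z < \<omega> / 2" "\<mu> (\<omega> / 2) - \<mu> 0 = (\<omega> / 2) * \<mu>' z"
    using MVT2[of 0 "\<omega> / 2" \<mu> \<mu>'] omega_pos DERIV_mu by auto
  then have "\<mu>' z > 0" using mu_0(2) omega_pos mu_mid by (smt (verit) mult_nonneg_nonpos half_gt_zero)
  have "\<exists>x\<in>closed_segment s z. \<mu>' x = 0"
  proof (cases "s \<le> z")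
    case True
    then obtain x where "s \<le> x" "x \<le> z" "\<mu>' x = 0"
      using IVT'[of \<mu>' s 0 z] s \<open>\<mu>' z > 0\<close> cont_mu' by auto
    then show ?thesis using True by (auto simp: closed_segment_eq_real_ivl)
  next
    case False
    then obtain x where "z \<le> x" "x \<le> s" "\<mu>' x = 0"
      using IVT2'[of \<mu>' s 0 z] s \<open>\<mu>' z > 0\<close> cont_mu' by auto
    then show ?thesis using False by (auto simp: closed_segment_eq_real_ivl)
  qed
  then obtain x where x: "x \<in> closed_segment s z" "\<mu>' x = 0" by blast
  then have "0 < x" "x < \<omega> / 2" using z assms by (auto simp: closed_segment_eq_real_ivl split: if_splits)
  then show False using mu'_nonzero x by blast
qed

lemma mu_strict_mono: "0 \<le> s \<Longrightarrow> s < t \<Longrightarrow> t \<le> \<omega> / 2 \<Longrightarrow> \<mu> s < \<mu> t"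
  by (rule DERIV_pos_imp_increasing_open[of s t \<mu>])
    (auto intro!: exI[of _ "\<mu>' _"] DERIV_mu mu'_pos cont_mu)

lemma mu_inj: "0 \<le> s \<Longrightarrow> s \<le> \<omega> / 2 \<Longrightarrow> 0 \<le> t \<Longrightarrow> t \<le> \<omega> / 2 \<Longrightarrow> \<mu> s = \<mu> t \<Longrightarrow> s = t"
  using mu_strict_mono[of s t] mu_strict_mono[of t s] by (cases s t rule: linorder_cases) auto

text \<open>\<open>{0..\<omega> / 2}\<close> is a fundamental domain for the symmetries of \<mu>,
  which are generated by the shift by \<omega> and the reflection in 0. Questions about values of
  \<mu> reduce to it.\<close>

lemma fold_parameter:
  obtains v k where "0 \<le> v" "v \<le> \<omega> / 2" "u = v + of_int k * \<omega> \<or> u = of_int k * \<omega> - v"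
proof -
  define k where "k = \<lfloor>u / \<omega>\<rfloor>"
  define v where "v = u - of_int k * \<omega>"
  have v: "0 \<le> v" "v < \<omega>"
    using omega_pos floor_divide_lower[of \<omega> u] floor_divide_upper[of \<omega> u]
    by (auto simp: v_def k_def algebra_simps)
  show ?thesis
  proof (cases "v \<le> \<omega> / 2")
    case True then show ?thesis using v that[of v k] by (simp add: v_def)
  next
    case False then show ?thesis using v that[of "\<omega> - v" "k + 1"] by (simp add: v_def algebra_simps)
  qed
qed

lemma mu_bounds: "\<mu> 0 \<le> \<mu> s" "\<mu> s \<le> e1 lam \<xi>"
proof -
  obtain v k where v: "0 \<le> v" "v \<le> \<omega> / 2" "s = v + of_int k * \<omega> \<or> s = of_int k * \<omega> - v"
    by (rule fold_parameter)
  then have "\<mu> s = \<mu> v" by (auto simp: mu_period_int mu_reflect_int)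
  moreover have "\<mu> 0 \<le> \<mu> v" using v mu_strict_mono[of 0 v] by (cases "v = 0") auto
  moreover have "\<mu> v \<le> \<mu> (\<omega> / 2)" using v mu_strict_mono[of v "\<omega> / 2"] by (cases "v = \<omega> / 2") auto
  ultimately show "\<mu> 0 \<le> \<mu> s" "\<mu> s \<le> e1 lam \<xi>" by (simp_all add: mu_mid)
qed

lemma mu_eq_interior:
  assumes "0 < s" "s < \<omega> / 2" "\<mu> u = \<mu> s"
  obtains k where "u = s + of_int k * \<omega> \<or> u = of_int k * \<omega> - s"
proof -
  obtain v k where v: "0 \<le> v" "v \<le> \<omega> / 2" "u = v + of_int k * \<omega> \<or> u = of_int k * \<omega> - v"
    by (rule fold_parameter)
  then have "\<mu> v = \<mu> s" using assms by (auto simp: mu_period_int mu_reflect_int)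
  then have "v = s" using mu_inj v assms by auto
  then show ?thesis using v that by blast
qed

end

subsection \<open>Polar coordinates of the projection\<close>

context normalized_B_solution
begin

section \<open>Lower bounds for \<mu> and passages through the axis\<close>

lemma four_xi_mu_ge: "4 * \<xi>^2 * (\<mu> s)^2 \<ge> 1"
proof -
  have "(\<mu> s)^2 * (\<mu> s + 2 * lam)^2 \<ge> 0" by simp
  then show ?thesis using mu_ineq[of s] by linarith
qed

lemma two_xi_mu_ge: "2 * \<xi> * \<mu> s \<ge> 1"
proof -
  have "1\<^sup>2 \<le> (2 * \<xi> * \<mu> s)^2"
    using four_xi_mu_ge[of s] by (simp add: power_mult_distrib)
  then show ?thesis by (rule power2_le_imp_le) (use xi_pos in simp)
qed

text \<open>If \<open>2 * \<xi> * \<mu> s = 1\<close>, then \<open>mu_ineq\<close> leaves only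
  \<open>\<mu> s = - 2 * lam\<close>, and the two values of \<open>\<mu> s\<close> together give
  \<open>4 * lam * \<xi> + 1 = 0\<close>.\<close>

lemma two_xi_mu_gt:
  assumes "4 * lam * \<xi> + 1 \<noteq> 0"
  shows "2 * \<xi> * \<mu> s > 1"
proof (rule ccontr)
  assume "\<not> ?thesis"
  then have *: "2 * \<xi> * \<mu> s = 1" using two_xi_mu_ge[of s] by simp
  then have mu: "\<mu> s = 1 / (2 * \<xi>)" using xi_pos by (simp add: field_simps)
  have "(2 * \<xi> * \<mu> s)^2 = 1" using * by simp
  then have "4 * \<xi>^2 * (\<mu> s)^2 = 1" by (simp add: power_mult_distrib)
  then have "(\<mu> s)^2 * (\<mu> s + 2 * lam)^2 \<le> 0" using mu_ineq[of s] by simp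
  then have "((\<mu> s + 2 * lam))^2 \<le> 0" by (simp add: mult_le_0_iff del: power2_less_eq_zero_iff)
  then have "\<mu> s + 2 * lam = 0" by simp
  then show False using assms xi_pos unfolding mu by (simp add: field_simps)
qed

text \<open>In this case \<open>t + 2 * lam\<close> divides \<open>Q\<close>, with root
  \<open>1 / (2 * \<xi>)\<close>. The other factor has at most one root beyond it, but
  \<open>\<mu> 0\<close> and \<open>e1\<close> are distinct roots, so the smaller one belongs to the
  linear factor.\<close>

lemma mu_0_degenerate:
  assumes deg: "4 * lam * \<xi> + 1 = 0"
  shows "2 * \<xi> * \<mu> 0 = 1"
proof (rule ccontr)
  assume ne: "2 * \<xi> * \<mu> 0 \<noteq> 1"
  have lam: "lam = - 1 / (4 * \<xi>)" using deg xi_pos by (simp add: field_simps)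
  \<comment> \<open>In this form of the remaining equation the left side increases in
    \<open>t\<close> and the right side decreases, which leaves at most one solution.\<close>
  have *: "t + 2 * lam = 4 * \<xi>^2 / t + 2 * \<xi> / t^2" if "t > 0" "2 * \<xi> * t > 1" "Q lam \<xi> t = 0" for t
  proof -
    have "Q lam \<xi> t = (t + 2 * lam) * (t^2 * (t + 2 * lam) - 2 * \<xi> * (1 + 2 * \<xi> * t))"
      using xi_pos by (simp add: Q_eq lam field_simps power2_eq_square)
    moreover have "t + 2 * lam \<noteq> 0" using that xi_pos by (simp add: lam field_simps)
    ultimately have "t^2 * (t + 2 * lam) = 2 * \<xi> * (1 + 2 * \<xi> * t)" using that by simp
    then show ?thesis using that by (simp add: field_simps power2_eq_square)
  qed
  have "2 * \<xi> * \<mu> 0 > 1" using ne two_xi_mu_ge[of 0] by simp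
  moreover have "2 * \<xi> * \<mu> 0 < 2 * \<xi> * e1 lam \<xi>" using mu_0(2) xi_pos by simp
  ultimately have "\<mu> 0 + 2 * lam = 4 * \<xi>^2 / \<mu> 0 + 2 * \<xi> / (\<mu> 0)^2"
    "e1 lam \<xi> + 2 * lam = 4 * \<xi>^2 / e1 lam \<xi> + 2 * \<xi> / (e1 lam \<xi>)^2"
    using mu_0(1) e1_root by (auto intro!: *)
  moreover have "4 * \<xi>^2 / e1 lam \<xi> \<le> 4 * \<xi>^2 / \<mu> 0"
    using mu_0(2) xi_pos by (intro divide_left_mono) (auto simp: e1_root)
  moreover have "2 * \<xi> / (e1 lam \<xi>)^2 \<le> 2 * \<xi> / (\<mu> 0)^2"
    using mu_0(2) xi_pos e1_root by (intro divide_left_mono power_mono) auto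
  ultimately show False using mu_0(2) by linarith
qed

text \<open>At these parameters \<open>x = 1\<close>, so they are the passages through the axis. In
  the degenerate case \<open>1 / (2 * \<xi>)\<close> is the minimum of \<mu>, attained once per
  period.\<close>

lemma two_xi_mu_eq_1_iff: "2 * \<xi> * \<mu> s = 1 \<longleftrightarrow> 4 * lam * \<xi> + 1 = 0 \<and> (\<exists>k::int. s = of_int k * \<omega>)"
proof (cases "4 * lam * \<xi> + 1 = 0")
  case True
  have "2 * \<xi> * \<mu> s = 1 \<longleftrightarrow> \<mu> s = \<mu> 0"
    using mu_0_degenerate[OF True] xi_pos by (metis mult_cancel_left less_irrefl mult_pos_pos zero_less_numeral)
  also have "\<dots> \<longleftrightarrow> (\<exists>k::int. s = of_int k * \<omega>)"
  proof
    assume s: "\<mu> s = \<mu> 0"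
    obtain v k where v: "0 \<le> v" "v \<le> \<omega> / 2" "s = v + of_int k * \<omega> \<or> s = of_int k * \<omega> - v"
      by (rule fold_parameter)
    then have "\<mu> v = \<mu> 0" using s by (auto simp: mu_period_int mu_reflect_int)
    then have "v = 0" using mu_inj v omega_pos by auto
    then show "\<exists>k::int. s = of_int k * \<omega>" using v by auto
  next
    assume "\<exists>k::int. s = of_int k * \<omega>"
    then show "\<mu> s = \<mu> 0" using mu_period_int[of 0] by auto
  qed
  finally show ?thesis using True by simp
qed (use two_xi_mu_gt[of s] in auto)

text \<open>
  The angular velocity of the projection; for \<open>4l\<xi> + 1 = 0\<close> the common factor \<open>\<mu> + 2l\<close> of numerator
  and denominator is cancelled.
\<close>

definition phi' :: "real \<Rightarrow> real" where
  "phi' s = (if 4 * lam * \<xi> + 1 = 0 then (\<mu> s)^2 / (1 + 2 * \<xi> * \<mu> s)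
    else 2 * \<xi> * ((\<mu> s)^2 * (\<mu> s + 2 * lam)) / (4 * \<xi>^2 * (\<mu> s)^2 - 1))"

text \<open>The projection of \<open>std_curve\<close> is a real multiple of
  \<open>- cis (- theta)\<close>, so its angle runs against \<open>theta\<close>; normalizing the
  angle to 0 at the parameter 0 makes it odd.\<close>

definition phi :: "real \<Rightarrow> real" where
  "phi s = theta lam \<xi> \<mu> \<omega> 0 - theta lam \<xi> \<mu> \<omega> s"

lemma four_xi_mu_gt:
  assumes "2 * \<xi> * \<mu> s \<noteq> 1"
  shows "4 * \<xi>^2 * (\<mu> s)^2 > 1"
proof -
  have "1^2 < (2 * \<xi> * \<mu> s)^2"
    using assms two_xi_mu_ge[of s] by (intro power_strict_mono) auto
  then show ?thesis by (simp add: power_mult_distrib)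
qed

lemma phi'_eq:
  assumes "2 * \<xi> * \<mu> s \<noteq> 1"
  shows "phi' s = - (2 * \<xi> * ((\<mu> s)^2 * (\<mu> s + 2 * lam) / (1 - 4 * \<xi>^2 * (\<mu> s)^2)))"
proof (cases "4 * lam * \<xi> + 1 = 0")
  case True
  then have lam: "2 * lam = - 1 / (2 * \<xi>)" using xi_pos by (simp add: field_simps)
  have "2 * \<xi> * \<mu> s > 0" using xi_pos by simp
  then have "1 + 2 * \<xi> * \<mu> s \<noteq> 0" by linarith
  moreover have "1 - 2 * \<xi> * \<mu> s \<noteq> 0" using assms by simp
  moreover have "1 - 4 * \<xi>^2 * (\<mu> s)^2 = (1 - 2 * \<xi> * \<mu> s) * (1 + 2 * \<xi> * \<mu> s)"
    by (simp add: algebra_simps power2_eq_square)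
  moreover have "2 * \<xi> * ((\<mu> s)^2 * (\<mu> s + 2 * lam)) = - ((\<mu> s)^2 * (1 - 2 * \<xi> * \<mu> s))"
    unfolding lam using xi_pos by (simp add: field_simps)
  moreover have "- (m * a) / (a * b) = - (m / b)" if "a \<noteq> 0" for a b m :: real
    using that by simp
  ultimately show ?thesis
    using True unfolding phi'_def times_divide_eq_right by simp
next
  case False
  have "4 * \<xi>^2 * (\<mu> s)^2 - 1 \<noteq> 0" "1 - 4 * \<xi>^2 * (\<mu> s)^2 \<noteq> 0"
    using four_xi_mu_gt[OF assms] by auto
  then show ?thesis using False unfolding phi'_def by (simp add: field_simps)
qed

lemma cont_phi': "continuous_on A phi'"
proof -
  have "1 + 2 * \<xi> * \<mu> s \<noteq> 0" for s using two_xi_mu_ge[of s] by linarith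
  moreover have "4 * \<xi>^2 * (\<mu> s)^2 - 1 \<noteq> 0" if "4 * lam * \<xi> + 1 \<noteq> 0" for s
    using four_xi_mu_gt[of s] two_xi_mu_gt[OF that, of s] by auto
  ultimately show ?thesis unfolding phi'_def[abs_def]
    by (cases "4 * lam * \<xi> + 1 = 0") (auto intro!: continuous_intros cont_mu)
qed

text \<open>Off a countable set the integrand of \<open>theta\<close> agrees with a continuous
  function, which may replace it under the integral; the fundamental theorem then applies at the
  removable singularities as well.\<close>

lemma DERIV_phi: "(phi has_real_derivative phi' s) (at s)"
proof -
  define h where "h t = (\<mu> t)^2 * (\<mu> t + 2 * lam) / (1 - 4 * \<xi>^2 * (\<mu> t)^2)" for t
  define g where "g t = - phi' t / (2 * \<xi>)" for t
  have cont_g: "continuous_on A g" for A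
    unfolding g_def[abs_def] using xi_pos by (intro continuous_intros cont_phi') auto
  have mu_meas: "\<mu> \<in> borel_measurable borel"
    by (rule borel_measurable_continuous_onI[OF cont_mu])
  have "countable {t. 2 * \<xi> * \<mu> t = 1}"
  proof (rule countable_subset)
    show "{t. 2 * \<xi> * \<mu> t = 1} \<subseteq> range (\<lambda>k::int. of_int k * \<omega>)"
      using two_xi_mu_eq_1_iff by auto
  qed simp
  then have "AE t in lborel. t \<notin> {t. 2 * \<xi> * \<mu> t = 1}"
    by (intro AE_not_in countable_imp_null_set_lborel)
  then have ae: "AE t in lborel. h t = g t"
  proof (rule AE_mp, intro AE_I2 impI)
    fix t assume "t \<notin> {t. 2 * \<xi> * \<mu> t = 1}"
    then show "h t = g t" using phi'_eq[of t] xi_pos by (simp add: g_def h_def)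
  qed
  have theta: "theta lam \<xi> \<mu> \<omega> u = 2 * \<xi> * (LBINT t=ereal (\<omega> / 2)..ereal u. g t)" for u
  proof -
    have "(LBINT t=ereal (\<omega> / 2)..ereal u. h t) = (LBINT t=ereal (\<omega> / 2)..ereal u. g t)"
    proof (rule interval_integral_cong_AE)
      show "h \<in> borel_measurable borel" unfolding h_def[abs_def] using mu_meas by measurable
      show "g \<in> borel_measurable borel" by (rule borel_measurable_continuous_onI[OF cont_g])
      show "AE t\<in>einterval (min (ereal (\<omega> / 2)) (ereal u)) (max (ereal (\<omega> / 2)) (ereal u)) in lborel. h t = g t"
        using ae by eventually_elim simp
    qed
    then show ?thesis unfolding theta_def h_def by simp
  qed
  \<comment> \<open>The fundamental theorem gives a derivative within an interval;
    \<open>{a..b}\<close> contains the base point \<open>\<omega> / 2\<close> and has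
    \<open>s\<close> in its interior.\<close>
  define a where "a = min s (\<omega> / 2) - 1"
  define b where "b = max s (\<omega> / 2) + 1"
  have "((\<lambda>u. LBINT t=ereal (\<omega> / 2)..ereal u. g t) has_vector_derivative g s) (at s within {a..b})"
    by (rule interval_integral_FTC2) (auto simp: a_def b_def cont_g)
  moreover have "at s within {a..b} = at s"
    by (rule at_within_interior) (auto simp: a_def b_def)
  ultimately have "((\<lambda>u. LBINT t=ereal (\<omega> / 2)..ereal u. g t) has_real_derivative g s) (at s)"
    unfolding has_real_derivative_iff_has_vector_derivative by metis
  then have "(phi has_real_derivative 0 - 2 * \<xi> * g s) (at s)"
    unfolding phi_def[abs_def] theta by (rule DERIV_diff[OF DERIV_const DERIV_cmult])
  then show ?thesis using xi_pos by (simp add: g_def)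
qed

lemma cont_phi: "continuous_on A phi"
  by (intro continuous_at_imp_continuous_on ballI DERIV_isCont[OF DERIV_phi])

lemma phi'_cong: "\<mu> s = \<mu> t \<Longrightarrow> phi' s = phi' t"
  by (simp add: phi'_def)

lemma phi_0 [simp]: "phi 0 = 0"
  by (simp add: phi_def)

text \<open>\<open>phi'\<close> depends only on \<mu> and is therefore even, so
  \<open>phi (- s) + phi s\<close> has derivative 0.\<close>

lemma phi_odd: "phi (- s) = - phi s"
proof -
  have "((\<lambda>s. phi (- s) + phi s) has_real_derivative - phi' (- t) + phi' t) (at t)" for t
    by (intro DERIV_add DERIV_phi DERIV_mirror[THEN iffD1, OF DERIV_phi])
  then have "((\<lambda>s. phi (- s) + phi s) has_real_derivative 0) (at t)" for t
    using phi'_cong[OF mu_even, of t] by (metis add.left_inverse)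
  then have "phi (- s) + phi s = phi (- 0) + phi 0"
    by (intro DERIV_isconst_all[where f = "\<lambda>s. phi (- s) + phi s"]) auto
  then show ?thesis by simp
qed

lemma phi_period: "phi (s + \<omega>) = phi s - Psi lam \<xi> \<mu> \<omega>"
proof -
  have "((\<lambda>s. phi (s + \<omega>) - phi s) has_real_derivative phi' (t + \<omega>) - phi' t) (at t)" for t
    by (intro DERIV_diff DERIV_phi DERIV_shift[THEN iffD1, OF DERIV_phi])
  then have "((\<lambda>s. phi (s + \<omega>) - phi s) has_real_derivative 0) (at t)" for t
    by (rule DERIV_cong) (simp add: phi'_cong[OF mu_period])
  then have "phi (s + \<omega>) - phi s = phi (0 + \<omega>) - phi 0"
    by (intro DERIV_isconst_all[where f = "\<lambda>s. phi (s + \<omega>) - phi s"]) auto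
  then show ?thesis by (simp add: phi_def Psi_def)
qed

lemma phi_period_nat: "phi (s + of_nat k * \<omega>) = phi s - of_nat k * Psi lam \<xi> \<mu> \<omega>"
proof (induction k)
  case (Suc k)
  have "s + of_nat (Suc k) * \<omega> = (s + of_nat k * \<omega>) + \<omega>" by (simp add: algebra_simps)
  then have "phi (s + of_nat (Suc k) * \<omega>) = phi (s + of_nat k * \<omega>) - Psi lam \<xi> \<mu> \<omega>"
    using phi_period by metis
  then show ?case using Suc by (simp add: algebra_simps)
qed simp

text \<open>Shifting from \<open>- (\<omega> / 2)\<close> to \<open>\<omega> / 2\<close> and using
  oddness yields half of the increment over a period.\<close>

lemma phi_mid: "phi (\<omega> / 2) = - Psi lam \<xi> \<mu> \<omega> / 2"
  using phi_period[of "- (\<omega> / 2)"] by (simp add: phi_odd)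

text \<open>In the nondegenerate case \<open>2 * \<xi> * \<mu> > 1\<close> gives
  \<open>2 * \<xi> * (\<mu> + 2 * lam) > 4 * lam * \<xi> + 1\<close>, so the numerator is
  positive.\<close>

lemma phi'_pos:
  assumes "4 * lam * \<xi> + 1 \<ge> 0"
  shows "phi' s > 0"
proof (cases "4 * lam * \<xi> + 1 = 0")
  case True
  have "1 + 2 * \<xi> * \<mu> s > 0" using two_xi_mu_ge[of s] by linarith
  then show ?thesis using True by (simp add: phi'_def)
next
  case False
  have "2 * \<xi> * (\<mu> s + 2 * lam) > 0"
    using two_xi_mu_gt[OF False, of s] assms by (simp add: algebra_simps)
  then have "\<mu> s + 2 * lam > 0" using xi_pos by (simp add: zero_less_mult_iff)
  moreover have "4 * \<xi>^2 * (\<mu> s)^2 - 1 > 0"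
    using four_xi_mu_gt[of s] two_xi_mu_gt[OF False, of s] by auto
  ultimately show ?thesis using False xi_pos by (simp add: phi'_def)
qed

lemma phi_strict_mono:
  assumes "4 * lam * \<xi> + 1 \<ge> 0" "s < t"
  shows "phi s < phi t"
  by (rule DERIV_pos_imp_increasing[OF assms(2)]) (use DERIV_phi phi'_pos[OF assms(1)] in blast)

text \<open>Signed radius: its absolute value is the distance from the axis. In the degenerate case
  the sign changes at each passage through the axis, so that the angle need not jump by \<pi>
  there.\<close>

definition rho :: "real \<Rightarrow> real" where
  "rho s = sigma lam \<xi> \<omega> s * (sqrt (4 * \<xi>^2 * (\<mu> s)^2 - 1) / (2 * \<xi> * \<mu> s))"

lemma sigma_nondeg: "4 * lam * \<xi> + 1 \<noteq> 0 \<Longrightarrow> sigma lam \<xi> \<omega> s = 1"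
  by (simp add: sigma_def)

lemma sigma_period: "sigma lam \<xi> \<omega> (s + \<omega>) = (if 4 * lam * \<xi> + 1 = 0 then - sigma lam \<xi> \<omega> s else sigma lam \<xi> \<omega> s)"
proof -
  have "(s + \<omega>) / \<omega> = s / \<omega> + 1" using omega_pos by (simp add: field_simps)
  then show ?thesis by (simp add: sigma_def)
qed

lemma sigma_sq: "(sigma lam \<xi> \<omega> s)^2 = 1"
  by (simp add: sigma_def)

lemma rho_period: "rho (s + \<omega>) = (if 4 * lam * \<xi> + 1 = 0 then - rho s else rho s)"
  by (simp add: rho_def sigma_period mu_period)

lemma rho_sq: "(rho s)^2 = 1 - 1 / (4 * \<xi>^2 * (\<mu> s)^2)"
proof -
  show ?thesis using four_xi_mu_ge[of s]
    using xi_pos by (simp add: rho_def power_mult_distrib power_divide sigma_sq diff_divide_distrib)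
qed

lemma rho_zero_iff: "rho s = 0 \<longleftrightarrow> 2 * \<xi> * \<mu> s = 1"
proof -
  have "rho s = 0 \<longleftrightarrow> (2 * \<xi> * \<mu> s)^2 = 1^2"
    using rho_sq[of s] xi_pos by (auto simp: power_mult_distrib)
  also have "\<dots> \<longleftrightarrow> 2 * \<xi> * \<mu> s = 1"
    using two_xi_mu_ge[of s] by (simp only: power2_eq_iff) linarith
  finally show ?thesis .
qed

lemma rho_pos: "4 * lam * \<xi> + 1 \<noteq> 0 \<Longrightarrow> rho s > 0"
  using four_xi_mu_gt[of s] two_xi_mu_gt[of s] xi_pos by (auto simp: rho_def sigma_nondeg)

text \<open>Restricted to the first period, where \<open>sigma\<close> is 1 in every case; in the
  degenerate case the sign alternates from then on.\<close>

lemma rho_nonneg: "0 \<le> s \<Longrightarrow> s < \<omega> \<Longrightarrow> rho s \<ge> 0"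
proof -
  assume "0 \<le> s" "s < \<omega>"
  then have "\<lfloor>s / \<omega>\<rfloor> = 0" using omega_pos by (simp add: floor_eq_iff)
  then have "sigma lam \<xi> \<omega> s = 1" by (simp add: sigma_def)
  then show ?thesis using xi_pos four_xi_mu_ge[of s] by (simp add: rho_def)
qed

lemma mu_eq_of_rho_sq: "(rho s)^2 = (rho t)^2 \<Longrightarrow> \<mu> s = \<mu> t"
  using xi_pos by (simp add: rho_sq power2_eq_iff_nonneg)

end

subsection \<open>The curve and its symmetries\<close>

lemma cis_eq_iff: "cis a = cis b \<longleftrightarrow> (\<exists>k::int. a = b + 2 * pi * of_int k)"
  using sin_cos_eq_iff[of a b] by (auto simp: complex_eq_iff)

lemma cis_eq_iff_diff: "cis a = cis b \<longleftrightarrow> cis (a - b) = 1"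
  by (simp flip: cis_divide)

lemma bounded_linear_proj_yz: "bounded_linear proj_yz"
proof (rule bounded_linear_intro[where K = 1])
  fix p :: "real^3"
  have "norm (proj_yz p) = sqrt ((p$2)^2 + (p$3)^2)" by (simp add: proj_yz_def cmod_def)
  also have "\<dots> \<le> sqrt ((p$1)^2 + (p$2)^2 + (p$3)^2)" by simp
  also have "\<dots> = norm p" by (simp add: norm_vec_def L2_set_def sum_3)
  finally show "norm (proj_yz p) \<le> norm p * 1" by simp
qed (simp_all add: proj_yz_def complex_eq_iff)

lemma vec3_eqI: "p$1 = q$1 \<Longrightarrow> proj_yz p = proj_yz q \<Longrightarrow> p = q"
  by (simp add: vec_eq_iff forall_3 proj_yz_def)

lemma in_Ox_axis_iff: "p \<in> Ox_axis \<longleftrightarrow> proj_yz p = 0"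
  by (simp add: Ox_axis_def proj_yz_def complex_eq_iff)

lemma rot_Ox_mult_1: "(rot_Ox a *v p) $ 1 = p$1"
  and proj_rot_Ox: "proj_yz (rot_Ox a *v p) = cis a * proj_yz p"
  by (simp_all add: rot_Ox_def proj_yz_def matrix_vector_mult_def sum_3 complex_eq_iff)

lemma invertible_rot_Ox: "invertible (rot_Ox a)"
proof -
  have "rot_Ox b ** rot_Ox (- b) = mat 1" for b
  proof -
    have "(cos b)\<^sup>2 + (sin b)\<^sup>2 = 1" by simp
    then show ?thesis
      by (simp add: rot_Ox_def matrix_matrix_mult_def vec_eq_iff forall_3 sum_3 mat_def power2_eq_square add.commute)
  qed
  from this[of a] this[of "- a"] show ?thesis by (auto simp: invertible_def)
qed

text \<open>Invertibility is carried through the induction because \<open>matrix_inv\<close> is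
  defined by choice and is known to be an inverse only for an invertible matrix.\<close>

lemma generated_group_invariant:
  assumes "A \<in> generated_group S"
    and "\<And>B. B \<in> S \<Longrightarrow> invertible B \<and> (\<lambda>p. B *v p) ` X = X"
  shows "invertible A \<and> (\<lambda>p. A *v p) ` X = X"
  using assms(1)
proof induction
  case (3 A)
  then have inv: "invertible A" and im: "(\<lambda>p. A *v p) ` X = X" by auto
  have i: "invertible (matrix_inv A)" "matrix_inv A ** A = mat 1"
    using inv someI_ex[of "\<lambda>A'. A ** A' = mat 1 \<and> A' ** A = mat 1"]
    by (auto simp: invertible_def matrix_inv_def)
  have "(\<lambda>p. matrix_inv A *v p) ` X = (\<lambda>p. matrix_inv A *v p) ` (\<lambda>p. A *v p) ` X"
    by (simp only: im)
  also have "\<dots> = X" by (simp add: image_image matrix_vector_mul_assoc i)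
  finally show ?case using i by blast
next
  case (4 A B)
  have "(\<lambda>p. (A ** B) *v p) ` X = (\<lambda>p. A *v p) ` (\<lambda>p. B *v p) ` X"
    by (simp add: image_image matrix_vector_mul_assoc)
  then show ?case using 4 invertible_mult by metis
qed (use assms(2) in \<open>auto simp: invertible_def\<close>)

locale characteristic_B_string = normalized_B_solution +
  fixes \<gamma> :: "real \<Rightarrow> real^3" and m n :: nat
  assumes gamma: "\<gamma> = std_curve lam \<xi> \<mu> \<omega>" and string: "B_string lam \<gamma>"
    and char_number: "characteristic_number lam \<xi> \<mu> \<omega> m n"
begin

definition phase :: complex where
  "phase = - cis (- theta lam \<xi> \<mu> \<omega> 0)"

lemma norm_phase [simp]: "norm phase = 1" and phase_neq_0 [simp]: "phase \<noteq> 0"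
  by (simp_all add: phase_def)

lemma phase_cnj [simp]: "phase * cnj phase = 1"
  by (simp add: phase_def cis_cnj cis_mult)

definition beta :: real where
  "beta = 2 * pi * (real m / real n)"

lemma m_less: "m < n" and coprime_mn: "coprime m n" and Psi_hat_eq: "Psi_hat lam \<xi> \<mu> \<omega> = beta"
  using char_number by (auto simp: characteristic_number_def beta_def)

lemma n_pos [simp]: "n > 0" using m_less by simp

lemma gamma_1: "\<gamma> s $ 1 = 1 / (2 * \<xi> * \<mu> s)"
  by (simp add: gamma std_curve_def)

lemma proj_gamma: "proj_yz (\<gamma> s) = phase * of_real (rho s) * cis (phi s)"
proof -
  have eq: "phase * of_real (rho s) * cis (phi s) = - of_real (rho s) * cis (- theta lam \<xi> \<mu> \<omega> s)"
    by (simp add: phase_def phi_def cis_mult)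
  show ?thesis
    unfolding eq by (simp add: gamma std_curve_def proj_yz_def rho_def complex_eq_iff)
qed

lemma proj_eq_0_iff: "proj_yz (\<gamma> s) = 0 \<longleftrightarrow> rho s = 0"
  by (simp add: proj_gamma)

lemma norm_proj: "norm (proj_yz (\<gamma> s)) = \<bar>rho s\<bar>"
  by (simp add: proj_gamma norm_mult)

lemma proj_eq_imp_mu: "proj_yz (\<gamma> s) = proj_yz (\<gamma> t) \<Longrightarrow> \<mu> s = \<mu> t"
proof (rule mu_eq_of_rho_sq)
  assume "proj_yz (\<gamma> s) = proj_yz (\<gamma> t)"
  then have "\<bar>rho s\<bar>\<^sup>2 = \<bar>rho t\<bar>\<^sup>2" by (simp only: norm_proj[symmetric])
  then show "(rho s)\<^sup>2 = (rho t)\<^sup>2" by simp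
qed

text \<open>The distance from the axis determines \<mu>, and \<mu> determines the height
  \<open>x\<close>.\<close>

lemma gamma_eq_iff: "\<gamma> s = \<gamma> t \<longleftrightarrow> proj_yz (\<gamma> s) = proj_yz (\<gamma> t)"
proof
  assume "proj_yz (\<gamma> s) = proj_yz (\<gamma> t)"
  then show "\<gamma> s = \<gamma> t" using proj_eq_imp_mu[of s t] by (intro vec3_eqI) (simp_all add: gamma_1)
qed simp

lemma gamma_eq_imp_mu: "\<gamma> s = \<gamma> t \<Longrightarrow> \<mu> s = \<mu> t"
  by (rule proj_eq_imp_mu) simp

text \<open>The summands in \<open>Psi_hat\<close> are chosen so that all cases give the same
  rotation: \<open>2 * pi\<close> is invisible to \<open>cis\<close>, and \<open>pi\<close> makes up
  for the sign change of \<open>rho\<close> in the degenerate case.\<close>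

lemma proj_period: "proj_yz (\<gamma> (s + \<omega>)) = cis (- beta) * proj_yz (\<gamma> s)"
proof -
  consider "4 * lam * \<xi> + 1 > 0" | "4 * lam * \<xi> + 1 = 0" | "4 * lam * \<xi> + 1 < 0" by linarith
  then show ?thesis
  proof cases
    case 1
    then have "Psi lam \<xi> \<mu> \<omega> = beta - 2 * pi" using Psi_hat_eq by (simp add: Psi_hat_def)
    moreover have "cis (phi s - (beta - 2 * pi)) = cis (- beta) * cis (phi s)"
      unfolding cis_mult cis_eq_iff by (intro exI[of _ 1]) simp
    ultimately show ?thesis using 1 by (simp add: proj_gamma rho_period phi_period)
  next
    case 2
    then have "Psi lam \<xi> \<mu> \<omega> = beta - pi" using Psi_hat_eq by (simp add: Psi_hat_def)
    moreover have "cis (phi s - (beta - pi)) = - (cis (- beta) * cis (phi s))"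
    proof -
      have "cis (phi s - (beta - pi)) = cis pi * (cis (- beta) * cis (phi s))"
        unfolding cis_mult by (simp add: algebra_simps)
      then show ?thesis by simp
    qed
    ultimately show ?thesis using 2 by (simp add: proj_gamma rho_period phi_period)
  next
    case 3
    then have "Psi lam \<xi> \<mu> \<omega> = beta" using Psi_hat_eq by (simp add: Psi_hat_def)
    moreover have "cis (phi s - beta) = cis (- beta) * cis (phi s)"
      unfolding cis_mult by simp
    ultimately show ?thesis using 3 by (simp add: proj_gamma rho_period phi_period)
  qed
qed

lemma proj_shift: "proj_yz (\<gamma> (s + of_int k * \<omega>)) = cis (- (beta * of_int k)) * proj_yz (\<gamma> s)"
proof -
  \<comment> \<open>Undoing the rotation at constant speed gives a function of period \<omega>, so
    that integer shifts of either sign come from \<open>has_period_int\<close>.\<close>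
  define f where "f s = cis (beta * s / \<omega>) * proj_yz (\<gamma> s)" for s
  have "has_period f \<omega>"
    unfolding has_period_def
  proof (intro conjI allI omega_pos)
    fix s
    have "f (s + \<omega>) = (cis (beta * (s + \<omega>) / \<omega>) * cis (- beta)) * proj_yz (\<gamma> s)"
      by (simp add: f_def proj_period)
    also have "beta * (s + \<omega>) / \<omega> = beta * s / \<omega> + beta" using omega_pos by (simp add: field_simps)
    finally show "f (s + \<omega>) = f s" by (simp add: cis_mult f_def)
  qed
  then have "f (s + of_int k * \<omega>) = f s" by (rule has_period_int)
  then have "cis (- (beta * (s + of_int k * \<omega>) / \<omega>)) * f (s + of_int k * \<omega>)
      = cis (- (beta * (s + of_int k * \<omega>) / \<omega>)) * f s" by simp
  moreover have "- (beta * (s + of_int k * \<omega>) / \<omega>) + beta * s / \<omega> = - (beta * of_int k)"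
    using omega_pos by (simp add: field_simps)
  ultimately show ?thesis
    by (simp add: f_def cis_mult flip: mult.assoc)
qed

text \<open>Since \<open>m\<close> and \<open>n\<close> are coprime, the rotation by
  \<open>beta\<close> has order exactly \<open>n\<close>.\<close>

lemma cis_beta_eq_1_iff: "cis (- (beta * of_int k)) = 1 \<longleftrightarrow> int n dvd k"
proof -
  have "cis (- (beta * of_int k)) = 1 \<longleftrightarrow> (\<exists>j::int. - (beta * of_int k) = 0 + 2 * pi * of_int j)"
    using cis_eq_iff[of _ 0] by simp
  also have "\<dots> \<longleftrightarrow> (\<exists>j::int. - (int m * k) = int n * j)"
  proof (rule ex_cong1)
    fix j :: int
    have "- (beta * of_int k) = 0 + 2 * pi * of_int j
        \<longleftrightarrow> (2 * pi) * (- (real m / real n * of_int k)) = (2 * pi) * of_int j"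
      by (simp add: beta_def mult.assoc)
    also have "\<dots> \<longleftrightarrow> - (real m / real n * of_int k) = of_int j"
      by (subst mult_cancel_left) simp
    also have "\<dots> \<longleftrightarrow> real_of_int (- (int m * k)) = real_of_int (int n * j)"
      using n_pos by (auto simp: field_simps)
    finally have "- (beta * of_int k) = 0 + 2 * pi * of_int j
        \<longleftrightarrow> real_of_int (- (int m * k)) = real_of_int (int n * j)" .
    then show "- (beta * of_int k) = 0 + 2 * pi * of_int j \<longleftrightarrow> - (int m * k) = int n * j"
      by (simp only: of_int_eq_iff)
  qed
  also have "\<dots> \<longleftrightarrow> int n dvd int m * k"
    by (simp flip: dvd_def)
  also have "\<dots> \<longleftrightarrow> int n dvd k"
    using coprime_mn by (simp add: coprime_dvd_mult_right_iff coprime_commute)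
  finally show ?thesis .
qed

text \<open>A point off the axis is fixed only by the trivial rotation, so only the class of the
  shift modulo \<open>n\<close> counts.\<close>

lemma gamma_shift_eq_iff:
  assumes "rho s \<noteq> 0"
  shows "\<gamma> (s + of_int k * \<omega>) = \<gamma> (s + of_int j * \<omega>) \<longleftrightarrow> int n dvd k - j"
proof -
  have "\<gamma> (s + of_int k * \<omega>) = \<gamma> (s + of_int j * \<omega>) \<longleftrightarrow>
      cis (- (beta * of_int k)) = cis (- (beta * of_int j))"
    using assms by (simp add: gamma_eq_iff proj_shift proj_eq_0_iff)
  also have "\<dots> \<longleftrightarrow> cis (- (beta * of_int (k - j))) = 1"
  proof -
    have "- (beta * of_int k) - - (beta * of_int j) = - (beta * of_int (k - j))"
      by (simp add: algebra_simps)
    then show ?thesis using cis_eq_iff_diff[of "- (beta * of_int k)" "- (beta * of_int j)"] by simp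
  qed
  finally show ?thesis by (simp only: cis_beta_eq_1_iff)
qed

lemma rho_mid: "rho (\<omega> / 2) \<noteq> 0"
proof -
  have "\<mu> 0 < \<mu> (\<omega> / 2)" using mu_0(2) mu_mid by simp
  then have "2 * \<xi> * \<mu> 0 < 2 * \<xi> * \<mu> (\<omega> / 2)" using xi_pos by simp
  then show ?thesis using two_xi_mu_ge[of 0] by (simp add: rho_zero_iff)
qed

text \<open>Stated for every \<open>f\<close> with the same coincidences as \<gamma>, to serve for
  the curve and for its projection. A period of \<open>f\<close> is one of \<mu>, hence some
  \<open>k * \<omega>\<close>; at \<open>\<omega> / 2\<close>, which is off the axis in every case,
  it forces \<open>n\<close> to divide \<open>k\<close>.\<close>

lemma is_least_period_factor:
  assumes "\<And>s t. f s = f t \<longleftrightarrow> \<gamma> s = \<gamma> t"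
  shows "is_least_period f (of_nat n * \<omega>)"
  unfolding is_least_period_def
proof (intro conjI allI impI)
  have "proj_yz (\<gamma> (s + of_int (int n) * \<omega>)) = proj_yz (\<gamma> s)" for s
    unfolding proj_shift by (simp add: cis_beta_eq_1_iff[of "int n", simplified])
  then have "f (s + of_nat n * \<omega>) = f s" for s
    unfolding assms gamma_eq_iff by simp
  then show "has_period f (of_nat n * \<omega>)"
    using omega_pos by (simp add: has_period_def)
  fix T assume T: "has_period f T"
  then have g: "\<gamma> (s + T) = \<gamma> s" for s using assms by (simp add: has_period_def)
  have "has_period \<mu> T" using T gamma_eq_imp_mu[OF g] by (simp add: has_period_def)
  then obtain k where k: "k > 0" "T = of_nat k * \<omega>" using least_period_divides[OF mu_lp] by metis
  have "\<gamma> (\<omega> / 2 + of_int (int k) * \<omega>) = \<gamma> (\<omega> / 2 + of_int 0 * \<omega>)"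
    using g[of "\<omega> / 2"] k by simp
  then have "int n dvd int k" using gamma_shift_eq_iff[OF rho_mid, of "int k" 0] by simp
  then have "n \<le> k" using k by (simp add: dvd_imp_le)
  then show "of_nat n * \<omega> \<le> T" using k omega_pos by simp
qed

lemma least_period_gamma: "least_period \<gamma> = of_nat n * \<omega>"
  and least_period_proj: "least_period (\<lambda>s. proj_yz (\<gamma> s)) = of_nat n * \<omega>"
  by (rule least_period_eqI, rule is_least_period_factor, simp add: gamma_eq_iff)+

lemma gamma_period_dvd: "int n dvd k \<Longrightarrow> \<gamma> (s + of_int k * \<omega>) = \<gamma> s"
  using cis_beta_eq_1_iff[of k] by (simp add: gamma_eq_iff proj_shift)

lemma range_invariant:
  assumes "A \<in> generated_group {rot_Ox (2 * pi / real n)}"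
  shows "(\<lambda>p. A *v p) ` range \<gamma> = range \<gamma>"
proof -
  have "coprime (int m) (int n)" using coprime_mn by simp
  \<comment> \<open>By Bezout the shift by \<open>- u * \<omega>\<close> rotates by
    \<open>beta * u = 2 * pi / n - 2 * pi * v\<close>, so the generating rotation only
    reparametrizes the curve.\<close>
  then obtain u v where uv: "u * int m + v * int n = 1"
    using bezout_int[of "int m" "int n"] by (auto simp: coprime_iff_gcd_eq_1)
  have rot: "rot_Ox (2 * pi / real n) *v \<gamma> s = \<gamma> (s + of_int (- u) * \<omega>)" for s
  proof (rule vec3_eqI)
    have "2 * pi / real n = - (beta * of_int (- u)) + 2 * pi * of_int v"
    proof -
      have "real_of_int (u * int m + v * int n) = 1" using uv by simp
      then have "2 * pi / real n = 2 * pi * (of_int u * real m + of_int v * real n) / real n" by simp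
      also have "\<dots> = - (beta * of_int (- u)) + 2 * pi * of_int v"
        using m_less by (simp add: beta_def add_divide_distrib algebra_simps)
      finally show ?thesis .
    qed
    then have "cis (2 * pi / real n) = cis (- (beta * of_int (- u)))"
      unfolding cis_eq_iff by blast
    then show "proj_yz (rot_Ox (2 * pi / real n) *v \<gamma> s) = proj_yz (\<gamma> (s + of_int (- u) * \<omega>))"
      unfolding proj_rot_Ox proj_shift by simp
    show "(rot_Ox (2 * pi / real n) *v \<gamma> s) $ 1 = \<gamma> (s + of_int (- u) * \<omega>) $ 1"
      unfolding rot_Ox_mult_1 gamma_1 mu_period_int by simp
  qed
  have "(\<lambda>p. rot_Ox (2 * pi / real n) *v p) ` range \<gamma> = range (\<lambda>s. \<gamma> (s + of_int (- u) * \<omega>))"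
    unfolding image_image rot by simp
  also have "\<dots> = range \<gamma>"
  proof -
    have "\<gamma> s \<in> range (\<lambda>s. \<gamma> (s + of_int (- u) * \<omega>))" for s
      by (rule range_eqI[of _ _ "s + of_int u * \<omega>"]) simp
    then show ?thesis by blast
  qed
  finally show ?thesis
    using generated_group_invariant[OF assms, of "range \<gamma>"] invertible_rot_Ox by blast
qed

lemma gamma_smooth: "smooth \<gamma>" and gamma_sphere: "\<gamma> s \<in> sphere 0 1"
  and gamma_unit_speed: "norm (velocity \<gamma> s) = 1"
  using string by (auto simp: B_string_def B_curve_def arclength_curve_def)

text \<open>The bounds are the heights \<open>1 / (2 * \<xi> * \<mu>)\<close> at the maximum and at
  the minimum of \<mu>.\<close>

lemma range_between_planes:
  "\<exists>c1 c2. 0 < c1 \<and> c1 < c2 \<and> c2 \<le> 1 \<and> range \<gamma> \<subseteq> {p \<in> upper_hemisphere. c1 \<le> p$1 \<and> p$1 \<le> c2}"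
proof (intro exI conjI)
  have pos: "0 < 2 * \<xi> * \<mu> s" for s using xi_pos by simp
  have e1: "0 < 2 * \<xi> * e1 lam \<xi>" using xi_pos e1_root by simp
  show "0 < 1 / (2 * \<xi> * e1 lam \<xi>)" using e1 by (rule divide_pos_pos[OF zero_less_one])
  show "1 / (2 * \<xi> * e1 lam \<xi>) < 1 / (2 * \<xi> * \<mu> 0)"
    using xi_pos mu_0(2) by (intro divide_strict_left_mono mult_pos_pos e1 pos) auto
  show "1 / (2 * \<xi> * \<mu> 0) \<le> 1" using two_xi_mu_ge[of 0] by (simp add: divide_le_eq_1)
  show "range \<gamma> \<subseteq> {p \<in> upper_hemisphere. 1 / (2 * \<xi> * e1 lam \<xi>) \<le> p$1 \<and> p$1 \<le> 1 / (2 * \<xi> * \<mu> 0)}"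
  proof clarify
    fix s
    have "1 / (2 * \<xi> * e1 lam \<xi>) \<le> 1 / (2 * \<xi> * \<mu> s)" "1 / (2 * \<xi> * \<mu> s) \<le> 1 / (2 * \<xi> * \<mu> 0)"
      using mu_bounds[of s] xi_pos by (intro divide_left_mono mult_pos_pos e1 pos mult_left_mono; simp)+
    moreover have "\<gamma> s \<in> upper_hemisphere"
      using gamma_sphere[of s] xi_pos by (simp add: upper_hemisphere_def gamma_1)
    ultimately show "\<gamma> s \<in> upper_hemisphere \<and> 1 / (2 * \<xi> * e1 lam \<xi>) \<le> \<gamma> s $ 1 \<and> \<gamma> s $ 1 \<le> 1 / (2 * \<xi> * \<mu> 0)"
      by (simp only: gamma_1)
  qed
qed

section \<open>The velocity in polar coordinates\<close>

lemma has_vector_derivative_gamma: "(\<gamma> has_vector_derivative velocity \<gamma> s) (at s)"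
  and cont_velocity: "continuous_on A (velocity \<gamma>)"
  using smooth_has_vector_derivative[OF gamma_smooth, of 0] smooth_continuous[OF gamma_smooth, of A 1]
  by simp_all

lemma has_vector_derivative_proj:
  "((\<lambda>s. proj_yz (\<gamma> s)) has_vector_derivative proj_yz (velocity \<gamma> s)) (at s)"
  by (rule bounded_linear.has_vector_derivative[OF bounded_linear_proj_yz has_vector_derivative_gamma])

text \<open>Velocity of the projection in the frame turning with \<open>phi\<close>, that is
  \<open>rho' + \<i> * rho * phi'\<close>. It is defined through \<open>velocity \<gamma>\<close>
  because the differentiability of \<open>rho\<close> is yet to be derived.\<close>

definition polar_velocity :: "real \<Rightarrow> complex" where
  "polar_velocity s = proj_yz (velocity \<gamma> s) * cnj phase * cis (- phi s)"

lemma proj_velocity: "proj_yz (velocity \<gamma> s) = phase * polar_velocity s * cis (phi s)"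
proof -
  have "phase * polar_velocity s * cis (phi s)
      = proj_yz (velocity \<gamma> s) * (phase * cnj phase) * (cis (- phi s) * cis (phi s))"
    by (simp add: polar_velocity_def mult_ac)
  then show ?thesis by (simp add: cis_mult)
qed

text \<open>Rotating the projection back by \<open>phi\<close> leaves \<open>rho\<close>, which thus
  inherits differentiability from \<gamma>, even where \<open>sigma\<close> jumps. Its derivative is
  real, and the vanishing imaginary part is the second claim.\<close>

lemma DERIV_rho: "(rho has_real_derivative Re (polar_velocity s)) (at s)"
  and Im_polar_velocity: "Im (polar_velocity s) = rho s * phi' s"
proof -
  have rho: "(\<lambda>s. proj_yz (\<gamma> s) * cnj phase * cis (- phi s)) = (\<lambda>s. complex_of_real (rho s))"
  proof
    fix s
    have "proj_yz (\<gamma> s) * cnj phase * cis (- phi s)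
        = of_real (rho s) * (phase * cnj phase) * (cis (phi s) * cis (- phi s))"
      by (simp add: proj_gamma mult_ac)
    then show "proj_yz (\<gamma> s) * cnj phase * cis (- phi s) = of_real (rho s)" by (simp add: cis_mult)
  qed
  have phi: "((\<lambda>s. - phi s) has_derivative (\<lambda>t. t * (- phi' s))) (at s)"
    using DERIV_minus[OF DERIV_phi[of s]] unfolding has_field_derivative_def
    by (rule has_derivative_eq_rhs) (simp add: fun_eq_iff mult.commute)
  have cis: "((\<lambda>s. cis (- phi s)) has_vector_derivative - phi' s *\<^sub>R (\<i> * cis (- phi s))) (at s)"
    using has_derivative_cis[OF phi] by (simp add: has_vector_derivative_def)
  have "((\<lambda>s. proj_yz (\<gamma> s) * cnj phase * cis (- phi s)) has_vector_derivative
      proj_yz (\<gamma> s) * cnj phase * (- phi' s *\<^sub>R (\<i> * cis (- phi s)))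
      + proj_yz (velocity \<gamma> s) * cnj phase * cis (- phi s)) (at s)"
    by (rule has_vector_derivative_mult[OF has_vector_derivative_mult_left[OF has_vector_derivative_proj] cis])
  moreover have "proj_yz (\<gamma> s) * cnj phase * (- phi' s *\<^sub>R (\<i> * cis (- phi s)))
      = - \<i> * of_real (phi' s) * of_real (rho s)"
    using fun_cong[OF rho, of s] by (simp add: scaleR_conv_of_real mult_ac)
  ultimately have d: "((\<lambda>s. complex_of_real (rho s)) has_vector_derivative
      - \<i> * of_real (phi' s) * of_real (rho s) + polar_velocity s) (at s)"
    unfolding rho by (simp add: polar_velocity_def)
  show "(rho has_real_derivative Re (polar_velocity s)) (at s)"
    using bounded_linear.has_vector_derivative[OF bounded_linear_Re d]
    by (simp add: has_real_derivative_iff_has_vector_derivative)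
  have "((\<lambda>s. 0) has_vector_derivative Im (- \<i> * of_real (phi' s) * of_real (rho s) + polar_velocity s)) (at s)"
    using bounded_linear.has_vector_derivative[OF bounded_linear_Im d] by simp
  then have "Im (- \<i> * of_real (phi' s) * of_real (rho s) + polar_velocity s) = 0"
    using vector_derivative_unique_at has_vector_derivative_const by blast
  then show "Im (polar_velocity s) = rho s * phi' s" by simp
qed

text \<open>The left side is the imaginary part of \<open>cnj p * p'\<close> for the projection
  \<open>p\<close>, in which the phase and \<open>phi\<close> cancel. It depends on \<mu> only, and
  its sign gives the direction of travel around the axis.\<close>

lemma angular_momentum: "\<gamma> s $ 2 * velocity \<gamma> s $ 3 - \<gamma> s $ 3 * velocity \<gamma> s $ 2 = (rho s)^2 * phi' s"
proof -
  have "\<gamma> s $ 2 * velocity \<gamma> s $ 3 - \<gamma> s $ 3 * velocity \<gamma> s $ 2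
      = Im (cnj (proj_yz (\<gamma> s)) * proj_yz (velocity \<gamma> s))"
    by (simp add: proj_yz_def)
  also have "cnj (proj_yz (\<gamma> s)) * proj_yz (velocity \<gamma> s)
      = of_real (rho s) * (phase * cnj phase) * (cis (- phi s) * cis (phi s)) * polar_velocity s"
    by (simp add: proj_gamma proj_velocity cis_cnj mult_ac)
  also have "\<dots> = of_real (rho s) * polar_velocity s" by (simp add: cis_mult)
  finally show ?thesis by (simp add: Im_polar_velocity power2_eq_square)
qed

lemma velocity_1: "velocity \<gamma> s $ 1 = - \<mu>' s / (2 * \<xi> * (\<mu> s)^2)"
proof -
  have "((\<lambda>s. \<gamma> s $ 1) has_real_derivative velocity \<gamma> s $ 1) (at s)"
    using bounded_linear.has_vector_derivative[OF bounded_linear_vec_nth has_vector_derivative_gamma]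
    by (simp add: has_real_derivative_iff_has_vector_derivative)
  moreover have "((\<lambda>s. 1 / (2 * \<xi> * \<mu> s)) has_real_derivative - \<mu>' s / (2 * \<xi> * (\<mu> s)^2)) (at s)"
    using xi_pos by (auto intro!: derivative_eq_intros DERIV_mu simp: field_simps power2_eq_square)
  ultimately show ?thesis using DERIV_unique by (simp add: gamma_1)
qed

text \<open>Otherwise the velocity of \<gamma> is parallel to the axis. Being orthogonal to
  \<gamma>, whose height is positive, it would vanish, against unit speed.\<close>

lemma polar_velocity_neq_0: "polar_velocity s \<noteq> 0"
proof
  assume "polar_velocity s = 0"
  then have "velocity \<gamma> s $ 2 = 0" "velocity \<gamma> s $ 3 = 0"
    using proj_velocity[of s] by (simp_all add: proj_yz_def complex_eq_iff)
  moreover have "((\<lambda>s. \<gamma> s \<bullet> \<gamma> s) has_vector_derivative \<gamma> s \<bullet> velocity \<gamma> s + velocity \<gamma> s \<bullet> \<gamma> s) (at s)"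
    by (rule bounded_bilinear.has_vector_derivative[OF bounded_bilinear_inner has_vector_derivative_gamma has_vector_derivative_gamma])
  moreover have "(\<lambda>s. \<gamma> s \<bullet> \<gamma> s) = (\<lambda>s. 1)"
    using gamma_sphere by (auto simp: norm_eq_1)
  ultimately have "((\<lambda>s. 1::real) has_vector_derivative 2 * (\<gamma> s \<bullet> velocity \<gamma> s)) (at s)"
    by (simp add: inner_commute)
  then have "2 * (\<gamma> s \<bullet> velocity \<gamma> s) = 0"
    by (rule vector_derivative_unique_at[OF _ has_vector_derivative_const])
  then have "\<gamma> s \<bullet> velocity \<gamma> s = 0" by simp
  then have "\<gamma> s $ 1 * velocity \<gamma> s $ 1 = 0"
    using \<open>velocity \<gamma> s $ 2 = 0\<close> \<open>velocity \<gamma> s $ 3 = 0\<close> by (simp add: inner_vec_def sum_3)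
  then have "velocity \<gamma> s = 0"
    using \<open>velocity \<gamma> s $ 2 = 0\<close> \<open>velocity \<gamma> s $ 3 = 0\<close> xi_pos
    by (simp add: vec_eq_iff forall_3 gamma_1)
  then show False using gamma_unit_speed[of s] by simp
qed

end

subsection \<open>Crossings, linking and turning numbers\<close>

text \<open>The values of \<open>f - g\<close> differ by multiples of \<open>2 * pi\<close>, so this
  continuous function is constant on a connected set. The factor \<open>z\<close> allows for lifts
  of curves that differ by a fixed rotation.\<close>

lemma cis_lift_unique:
  fixes f g :: "real \<Rightarrow> real"
  assumes "connected S" "continuous_on S f" "continuous_on S g"
    and eq: "\<And>s. s \<in> S \<Longrightarrow> cis (f s) = z * cis (g s)" and ab: "a \<in> S" "b \<in> S"
  shows "f b - f a = g b - g a"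
proof -
  have "(\<lambda>s. f s - g s) constant_on S"
  proof (rule continuous_discrete_range_constant[OF assms(1)])
    show "continuous_on S (\<lambda>s. f s - g s)" using assms by (intro continuous_intros)
    fix x assume x: "x \<in> S"
    have "2 * pi \<le> norm ((f y - g y) - (f x - g x))" if y: "y \<in> S" "f y - g y \<noteq> f x - g x" for y
    proof -
      have z: "cis (f t - g t) = z" if "t \<in> S" for t
        using eq[OF that] by (simp flip: cis_divide)
      then have "cis (f y - g y) = cis (f x - g x)" using x y by simp
      then obtain k :: int where k: "f y - g y = (f x - g x) + 2 * pi * of_int k"
        by (auto simp: cis_eq_iff)
      then have "k \<noteq> 0" using y by auto
      then have "1 \<le> \<bar>real_of_int k\<bar>" by linarith
      then have "2 * pi * 1 \<le> 2 * pi * \<bar>real_of_int k\<bar>" by (intro mult_left_mono) auto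
      then show ?thesis using k by (simp add: abs_mult)
    qed
    then show "\<exists>e>0. \<forall>y. y \<in> S \<and> f y - g y \<noteq> f x - g x \<longrightarrow> e \<le> norm ((f y - g y) - (f x - g x))"
      by (intro exI[of _ "2 * pi"]) auto
  qed
  then have "f b - g b = f a - g a" using ab by (auto simp: constant_on_def)
  then show ?thesis by simp
qed

context characteristic_B_string
begin

section \<open>Self-intersections and their number\<close>

lemma rho_even: "4 * lam * \<xi> + 1 \<noteq> 0 \<Longrightarrow> rho (- s) = rho s"
  by (simp add: rho_def sigma_nondeg mu_even)

text \<open>The points at \<open>s\<close> and \<open>- s\<close> have the same radius and opposite
  angles. After the shifts they agree iff \<open>2 * phi s\<close> and \<open>beta * (j - k)\<close>
  are congruent modulo \<open>2 * pi\<close>.\<close>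

lemma reflect_eq_iff:
  assumes nd: "4 * lam * \<xi> + 1 \<noteq> 0"
  shows "\<gamma> (of_int k * \<omega> - s) = \<gamma> (s + of_int j * \<omega>)
    \<longleftrightarrow> (\<exists>i::int. phi s = pi * of_int (int m * (j - k) - int n * i) / real n)"
proof -
  have r: "phase \<noteq> 0" "rho s \<noteq> 0" using rho_pos[OF nd, of s] by auto
  have "of_int k * \<omega> - s = - s + of_int k * \<omega>" by simp
  then have "proj_yz (\<gamma> (of_int k * \<omega> - s)) = cis (- (beta * of_int k)) * proj_yz (\<gamma> (- s))"
    by (simp only: proj_shift)
  also have "\<dots> = cis (- (beta * of_int k)) * (phase * of_real (rho (- s)) * cis (- phi s))"
    by (simp only: proj_gamma phi_odd)
  also have "\<dots> = phase * of_real (rho s) * (cis (- (beta * of_int k)) * cis (- phi s))"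
    by (simp only: rho_even[OF nd] mult_ac)
  also have "\<dots> = phase * of_real (rho s) * cis (- (beta * of_int k) - phi s)"
    by (simp only: cis_mult diff_conv_add_uminus)
  finally have "proj_yz (\<gamma> (of_int k * \<omega> - s)) = phase * of_real (rho s) * cis (- (beta * of_int k) - phi s)" .
  moreover have "proj_yz (\<gamma> (s + of_int j * \<omega>)) = phase * of_real (rho s) * cis (- (beta * of_int j) + phi s)"
    unfolding proj_shift unfolding proj_gamma cis_mult[symmetric] by (simp only: mult_ac)
  ultimately have "\<gamma> (of_int k * \<omega> - s) = \<gamma> (s + of_int j * \<omega>)
    \<longleftrightarrow> cis (- (beta * of_int k) - phi s) = cis (- (beta * of_int j) + phi s)"
    using r by (simp add: gamma_eq_iff)
  also have "\<dots> \<longleftrightarrow> (\<exists>i::int. - (beta * of_int k) - phi s = (- (beta * of_int j) + phi s) + 2 * pi * of_int i)"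
    by (rule cis_eq_iff)
  also have "\<dots> \<longleftrightarrow> (\<exists>i::int. phi s = pi * of_int (int m * (j - k) - int n * i) / real n)"
  proof (rule ex_cong1)
    fix i :: int
    have aux: "- b - f = (- a + f) + 2 * c \<longleftrightarrow> f = (a - b) / 2 - c" for a b c f :: real
      by (auto simp: field_simps)
    have eq: "pi * of_int (int m * (j - k) - int n * i) / real n = (beta * of_int j - beta * of_int k) / 2 - pi * of_int i"
      using m_less by (simp add: beta_def field_simps)
    show "- (beta * of_int k) - phi s = (- (beta * of_int j) + phi s) + 2 * pi * of_int i
      \<longleftrightarrow> phi s = pi * of_int (int m * (j - k) - int n * i) / real n"
      unfolding eq aux[symmetric] by (simp only: mult.assoc)
  qed
  finally show ?thesis .
qed

text \<open>
  Up to the shifts by \<open>\<omega>\<close>, these are the parameters at which the curve meets its mirror image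
  \<open>s \<mapsto> \<gamma> (- s)\<close>, rotated by a multiple of \<open>2\<pi>/n\<close>.
\<close>

definition crossing :: "real set" where
  "crossing = {s. 0 < s \<and> s < \<omega> / 2 \<and> (\<exists>l::int. phi s = pi * of_int l / real n)}"

lemma crossing_partner:
  assumes nd: "4 * lam * \<xi> + 1 \<noteq> 0" and s: "s \<in> crossing"
  obtains k :: int where "1 \<le> k" "k \<le> int n" "\<gamma> (of_int k * \<omega> - s) = \<gamma> (s + of_int j * \<omega>)"
proof -
  obtain l :: int where l: "phi s = pi * of_int l / real n" using s by (auto simp: crossing_def)
  have "coprime (int m) (int n)" using coprime_mn by simp
  then obtain u v where uv: "u * int m + v * int n = 1"
    using bezout_int[of "int m" "int n"] by (auto simp: coprime_iff_gcd_eq_1)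
  \<comment> \<open>Bezout solves \<open>m * (j - k) - n * i = l\<close>, with
    \<open>i = - (l * v)\<close>.\<close>
  define k where "k = j - l * u"
  \<comment> \<open>The representatives run from 1 to \<open>n\<close>, not from 0: for these the
    parameter \<open>k' * \<omega> - s\<close> lies in \<open>{0..<n * \<omega>}\<close>.\<close>
  define k' where "k' = (k - 1) mod int n + 1"
  have "l = int m * (j - k) - int n * (- (l * v))"
  proof -
    have "l = l * (u * int m + v * int n)" using uv by simp
    then show ?thesis by (simp add: k_def algebra_simps)
  qed
  then have *: "\<gamma> (of_int k * \<omega> - s) = \<gamma> (s + of_int j * \<omega>)"
    using reflect_eq_iff[OF nd, of k s j] l by metis
  have "int n dvd (k - 1) mod int n - (k - 1)" by (simp add: mod_eq_dvd_iff[symmetric])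
  then have "int n dvd k' - k" by (simp add: k'_def algebra_simps)
  then have "\<gamma> ((of_int k * \<omega> - s) + of_int (k' - k) * \<omega>) = \<gamma> (of_int k * \<omega> - s)"
    by (rule gamma_period_dvd)
  then have "\<gamma> (of_int k' * \<omega> - s) = \<gamma> (s + of_int j * \<omega>)"
    using * by (simp add: algebra_simps)
  moreover have "1 \<le> k'" "k' \<le> int n"
  proof -
    have "0 < int n" by simp
    from pos_mod_bound[OF this, of "k - 1"] pos_mod_sign[OF this, of "k - 1"]
    show "1 \<le> k'" "k' \<le> int n" unfolding k'_def by linarith+
  qed
  ultimately show ?thesis using that by blast
qed

definition crossing_point :: "real \<times> nat \<Rightarrow> real^3" where
  "crossing_point = (\<lambda>(s, i). \<gamma> (s + of_nat i * \<omega>))"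

lemma param_range:
  fixes k :: int
  assumes "0 < s" "s < \<omega>"
  shows "s + of_int k * \<omega> \<in> {0..<of_nat n * \<omega>} \<longleftrightarrow> 0 \<le> k \<and> k < int n"
    and "of_int k * \<omega> - s \<in> {0..<of_nat n * \<omega>} \<longleftrightarrow> 1 \<le> k \<and> k \<le> int n"
proof -
  have less: "a < b" if "of_int a * \<omega> < of_int b * \<omega>" for a b :: int
    using that omega_pos by simp
  have mono: "of_int a * \<omega> \<le> of_int b * \<omega>" if "a \<le> b" for a b :: int
    using that omega_pos by simp
  have n: "of_nat n * \<omega> = of_int (int n) * \<omega>"
    and one: "of_int (1::int) * \<omega> = \<omega>" and zero: "of_int (0::int) * \<omega> = 0"
    and minus: "of_int (- 1 :: int) * \<omega> = - \<omega>"
    and succ: "of_int (i + 1) * \<omega> = of_int i * \<omega> + \<omega>" for i :: int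
    by (simp_all add: algebra_simps)
  show "s + of_int k * \<omega> \<in> {0..<of_nat n * \<omega>} \<longleftrightarrow> 0 \<le> k \<and> k < int n"
  proof
    assume *: "s + of_int k * \<omega> \<in> {0..<of_nat n * \<omega>}"
    have "- 1 < k"
      by (rule less) (use * assms in \<open>unfold minus atLeastLessThan_iff, linarith\<close>)
    moreover have "k < int n"
      by (rule less) (use * assms in \<open>unfold n atLeastLessThan_iff, linarith\<close>)
    ultimately show "0 \<le> k \<and> k < int n" by simp
  next
    assume "0 \<le> k \<and> k < int n"
    then show "s + of_int k * \<omega> \<in> {0..<of_nat n * \<omega>}"
      using mono[of 0 k] mono[of "k + 1" "int n"] assms unfolding n zero succ atLeastLessThan_iff
      by linarith
  qed
  show "of_int k * \<omega> - s \<in> {0..<of_nat n * \<omega>} \<longleftrightarrow> 1 \<le> k \<and> k \<le> int n"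
  proof
    assume *: "of_int k * \<omega> - s \<in> {0..<of_nat n * \<omega>}"
    have "0 < k"
      by (rule less) (use * assms in \<open>unfold zero atLeastLessThan_iff, linarith\<close>)
    moreover have "k < int n + 1"
      by (rule less) (use * assms in \<open>unfold succ n atLeastLessThan_iff, linarith\<close>)
    ultimately show "1 \<le> k \<and> k \<le> int n" by simp
  next
    assume "1 \<le> k \<and> k \<le> int n"
    then show "of_int k * \<omega> - s \<in> {0..<of_nat n * \<omega>}"
      using mono[of 1 k] mono[of k "int n"] assms unfolding n one atLeastLessThan_iff by linarith
  qed
qed

lemma dvd_diff_imp_eq:
  fixes a b :: int
  assumes "int n dvd a - b" "c \<le> a" "a < c + int n" "c \<le> b" "b < c + int n"
  shows "a = b"
proof (rule ccontr)
  assume "a \<noteq> b"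
  then have "int n \<le> \<bar>a - b\<bar>" using dvd_imp_le_int[OF _ assms(1)] by simp
  then show False using assms(2-5) by linarith
qed

lemma crossing_bounds: "s \<in> crossing \<Longrightarrow> 0 < s" "s \<in> crossing \<Longrightarrow> s < \<omega> / 2" "s \<in> crossing \<Longrightarrow> s < \<omega>"
  using omega_pos by (auto simp: crossing_def)

text \<open>\<mu> is injective on \<open>{0..\<omega> / 2}\<close> and recovers \<open>s\<close>;
  then \<open>i\<close> is determined modulo \<open>n\<close>.\<close>

lemma inj_crossing_point:
  assumes nd: "4 * lam * \<xi> + 1 \<noteq> 0"
  shows "inj_on crossing_point (SIGMA s:crossing. {..<n})"
proof (rule inj_onI, clarify)
  fix s i t j
  assume s: "s \<in> crossing" and t: "t \<in> crossing" and i: "i < n" and j: "j < n"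
    and eq: "crossing_point (s, i) = crossing_point (t, j)"
  have eq: "\<gamma> (s + of_int (int i) * \<omega>) = \<gamma> (t + of_int (int j) * \<omega>)"
    using eq by (simp add: crossing_point_def)
  then have "\<mu> s = \<mu> t" using gamma_eq_imp_mu mu_period_int by metis
  then have st: "s = t" using mu_inj[of s t] crossing_bounds[OF s] crossing_bounds[OF t] by simp
  then have "int n dvd int i - int j" using eq gamma_shift_eq_iff[of t "int i" "int j"] rho_pos[OF nd, of t] by simp
  then have "int i = int j" by (rule dvd_diff_imp_eq[where c = 0]) (use i j in auto)
  then show "s = t \<and> i = j" using st by simp
qed

text \<open>Parameters with the same value of \<mu> are the shifts of \<open>s\<close> and of
  \<open>- s\<close>, and each of these two families meets the point once per least period.\<close>

lemma crossing_fibre: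
  assumes nd: "4 * lam * \<xi> + 1 \<noteq> 0" and s: "s \<in> crossing" and i: "i < n"
  obtains k where "{u \<in> {0..<least_period \<gamma>}. \<gamma> u = crossing_point (s, i)} = {s + of_nat i * \<omega>, of_int k * \<omega> - s}"
    "s + of_nat i * \<omega> \<noteq> of_int k * \<omega> - s"
proof -
  note b = crossing_bounds[OF s]
  obtain k :: int where k: "1 \<le> k" "k \<le> int n" "\<gamma> (of_int k * \<omega> - s) = \<gamma> (s + of_int (int i) * \<omega>)"
    by (rule crossing_partner[OF nd s])
  have p: "crossing_point (s, i) = \<gamma> (s + of_int (int i) * \<omega>)" by (simp add: crossing_point_def)
  have "{u \<in> {0..<least_period \<gamma>}. \<gamma> u = crossing_point (s, i)} = {s + of_int (int i) * \<omega>, of_int k * \<omega> - s}"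
  proof (intro equalityI subsetI)
    fix u assume "u \<in> {u \<in> {0..<least_period \<gamma>}. \<gamma> u = crossing_point (s, i)}"
    then have u: "u \<in> {0..<of_nat n * \<omega>}" "\<gamma> u = \<gamma> (s + of_int (int i) * \<omega>)"
      by (auto simp: least_period_gamma p)
    then have "\<mu> u = \<mu> s" using gamma_eq_imp_mu[OF u(2)] by (simp only: mu_period_int)
    then obtain j where "u = s + of_int j * \<omega> \<or> u = of_int j * \<omega> - s"
      using mu_eq_interior[OF b(1,2)] by metis
    then show "u \<in> {s + of_int (int i) * \<omega>, of_int k * \<omega> - s}"
    proof
      assume j: "u = s + of_int j * \<omega>"
      then have "int n dvd j - int i"
        using u(2) gamma_shift_eq_iff[of s j "int i"] rho_pos[OF nd, of s] by simp
      moreover have "0 \<le> j \<and> j < int n" using u(1) param_range(1)[OF b(1,3)] j by simp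
      ultimately have "j = int i" using i by (intro dvd_diff_imp_eq[where c = 0]) auto
      then show ?thesis using j by simp
    next
      assume j: "u = of_int j * \<omega> - s"
      then have "\<gamma> (- s + of_int j * \<omega>) = \<gamma> (- s + of_int k * \<omega>)" using u(2) k(3) by simp
      then have "int n dvd j - k" using gamma_shift_eq_iff[of "- s" j k] rho_pos[OF nd, of "- s"] by simp
      moreover have "1 \<le> j \<and> j \<le> int n" using u(1) param_range(2)[OF b(1,3)] j by simp
      ultimately have "j = k" using k by (intro dvd_diff_imp_eq[where c = 1]) auto
      then show ?thesis using j by simp
    qed
  next
    fix u assume "u \<in> {s + of_int (int i) * \<omega>, of_int k * \<omega> - s}"
    moreover have "s + of_int (int i) * \<omega> \<in> {0..<of_nat n * \<omega>}" "of_int k * \<omega> - s \<in> {0..<of_nat n * \<omega>}"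
      using param_range[OF b(1,3)] k i by (simp_all only:) auto
    ultimately show "u \<in> {u \<in> {0..<least_period \<gamma>}. \<gamma> u = crossing_point (s, i)}"
      using k(3) by (auto simp: least_period_gamma p)
  qed
  \<comment> \<open>Equality would make \<open>2 * s\<close> a multiple of \<omega>, although it
    lies strictly between 0 and \<omega>.\<close>
  moreover have "s + of_nat i * \<omega> \<noteq> of_int k * \<omega> - s"
  proof
    assume "s + of_nat i * \<omega> = of_int k * \<omega> - s"
    then have eq: "2 * s = of_int (k - int i) * \<omega>" by (simp add: algebra_simps)
    have "0 < of_int (k - int i) * \<omega>" "of_int (k - int i) * \<omega> < 1 * \<omega>"
      unfolding eq[symmetric] using b by auto
    then have "0 < k - int i" "real_of_int (k - int i) < 1"
      using omega_pos by (auto simp: zero_less_mult_iff simp del: of_int_diff)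
    then show False by linarith
  qed
  ultimately show ?thesis using that by simp
qed

lemma crossing_point_self_intersection:
  assumes nd: "4 * lam * \<xi> + 1 \<noteq> 0" and "s \<in> crossing" "i < n"
  shows "crossing_point (s, i) \<in> self_intersection_points \<gamma>"
proof -
  obtain k where "{u \<in> {0..<least_period \<gamma>}. \<gamma> u = crossing_point (s, i)} = {s + of_nat i * \<omega>, of_int k * \<omega> - s}"
    "s + of_nat i * \<omega> \<noteq> of_int k * \<omega> - s"
    by (rule crossing_fibre[OF assms])
  then show ?thesis unfolding self_intersection_points_def by blast
qed

text \<open>The angular momenta of the two branches agree and are positive, so parallel velocities
  would be equal. But their \<open>x\<close>-components are opposite and nonzero, since
  \<open>\<mu>'\<close> is odd and does not vanish at \<open>s\<close>.\<close>

lemma crossing_transversal: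
  assumes nd: "4 * lam * \<xi> + 1 > 0" and s: "s \<in> crossing"
    and eq: "\<gamma> (of_int k * \<omega> - s) = \<gamma> (s + of_nat i * \<omega>)"
  shows "\<not> collinear {0, velocity \<gamma> (s + of_nat i * \<omega>), velocity \<gamma> (of_int k * \<omega> - s)}"
proof
  let ?u = "s + of_nat i * \<omega>" and ?t = "of_int k * \<omega> - s"
  have nd': "4 * lam * \<xi> + 1 \<noteq> 0" using nd by simp
  have nz: "velocity \<gamma> x \<noteq> 0" for x using gamma_unit_speed[of x] by auto
  assume "collinear {0, velocity \<gamma> ?u, velocity \<gamma> ?t}"
  then obtain c where c: "velocity \<gamma> ?t = c *\<^sub>R velocity \<gamma> ?u"
    using nz by (auto simp: collinear_lemma)
  have mu: "\<mu> ?t = \<mu> ?u" by (rule gamma_eq_imp_mu[OF eq])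
  define J where "J = (rho ?u)^2 * phi' ?u"
  have "J > 0" using rho_pos[OF nd', of ?u] phi'_pos[of ?u] nd by (simp add: J_def)
  have "(rho ?t)^2 * phi' ?t = J" using phi'_cong[OF mu] by (simp add: J_def rho_sq mu)
  then have "J = \<gamma> ?t $ 2 * velocity \<gamma> ?t $ 3 - \<gamma> ?t $ 3 * velocity \<gamma> ?t $ 2"
    by (simp add: angular_momentum)
  also have "\<dots> = c * (\<gamma> ?u $ 2 * velocity \<gamma> ?u $ 3 - \<gamma> ?u $ 3 * velocity \<gamma> ?u $ 2)"
    unfolding eq c by (simp add: algebra_simps)
  also have "\<dots> = c * J" by (simp only: angular_momentum J_def)
  finally have "c = 1" using \<open>J > 0\<close> by simp
  then have "velocity \<gamma> ?t $ 1 = velocity \<gamma> ?u $ 1" using c by simp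
  then have "\<mu>' ?t = \<mu>' ?u" using xi_pos unfolding velocity_1 mu by simp
  moreover have "\<mu>' ?u = \<mu>' s" using mu'_period_int[of s "int i"] by simp
  moreover have "\<mu>' ?t = - \<mu>' s" using mu'_period_int[of "- s" k] by (simp add: mu'_odd)
  moreover have "\<mu>' s > 0" using crossing_bounds[OF s] by (intro mu'_pos)
  ultimately show False by simp
qed

text \<open>Of two parameters with the same image, one is a shift of some \<open>v\<close> and the
  other a shift of \<open>- v\<close>, with \<open>v\<close> strictly between 0 and
  \<open>\<omega> / 2\<close>; then \<open>reflect_eq_iff\<close> makes \<open>v\<close> a crossing.
  The other inclusion rests on transversality.\<close>

lemma ordinary_double_points_eq:
  assumes pos: "4 * lam * \<xi> + 1 > 0"
  shows "ordinary_double_points \<gamma> = crossing_point ` (SIGMA s:crossing. {..<n})"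
proof (intro equalityI subsetI)
  have nd: "4 * lam * \<xi> + 1 \<noteq> 0" using pos by simp
  {
    fix p assume "p \<in> crossing_point ` (SIGMA s:crossing. {..<n})"
    then obtain s i where s: "s \<in> crossing" and i: "i < n" and p: "p = crossing_point (s, i)" by blast
    obtain k where k: "{u \<in> {0..<least_period \<gamma>}. \<gamma> u = p} = {s + of_nat i * \<omega>, of_int k * \<omega> - s}"
      "s + of_nat i * \<omega> \<noteq> of_int k * \<omega> - s"
      unfolding p by (rule crossing_fibre[OF nd s i])
    have "of_int k * \<omega> - s \<in> {u \<in> {0..<least_period \<gamma>}. \<gamma> u = p}" unfolding k(1) by simp
    then have "\<gamma> (of_int k * \<omega> - s) = \<gamma> (s + of_nat i * \<omega>)" by (simp add: p crossing_point_def)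
    then show "p \<in> ordinary_double_points \<gamma>"
      using k crossing_transversal[OF pos s] unfolding ordinary_double_points_def by blast
  next
    fix p assume "p \<in> ordinary_double_points \<gamma>"
    then obtain x y where xy: "x \<noteq> y" and f: "{u \<in> {0..<least_period \<gamma>}. \<gamma> u = p} = {x, y}"
      by (auto simp: ordinary_double_points_def)
    then have x: "x \<in> {0..<of_nat n * \<omega>}" "\<gamma> x = p" and y: "y \<in> {0..<of_nat n * \<omega>}" "\<gamma> y = p"
      unfolding least_period_gamma[symmetric] by blast+
    \<comment> \<open>Such a shift must be by a multiple of \<open>n * \<omega>\<close>, too long
      for two distinct parameters in one least period.\<close>
    have no_shift: False if "a \<noteq> b" "a \<in> {0..<of_nat n * \<omega>}" "b \<in> {0..<of_nat n * \<omega>}" "\<gamma> a = \<gamma> b"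
      "b = a + of_int k * \<omega>" for a b and k :: int
    proof -
      have "\<gamma> (a + of_int k * \<omega>) = \<gamma> (a + of_int 0 * \<omega>)" using that by simp
      then have d: "int n dvd k" using gamma_shift_eq_iff[of a k 0] rho_pos[OF nd, of a] by simp
      have "\<bar>of_int k * \<omega>\<bar> < of_nat n * \<omega>" using that by auto
      then have "\<bar>real_of_int k\<bar> * \<omega> < of_nat n * \<omega>" using omega_pos by (simp add: abs_mult)
      then have "\<bar>k\<bar> < int n" using omega_pos by simp
      then have "k = 0" using d dvd_imp_le_int[of k "int n"] by force
      then show False using that by simp
    qed
    have mu: "\<mu> x = \<mu> y" using x y gamma_eq_imp_mu by simp
    obtain v k where v: "0 \<le> v" "v \<le> \<omega> / 2" and xk: "x = v + of_int k * \<omega> \<or> x = of_int k * \<omega> - v"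
      by (rule fold_parameter)
    obtain v' j where v': "0 \<le> v'" "v' \<le> \<omega> / 2" and yj: "y = v' + of_int j * \<omega> \<or> y = of_int j * \<omega> - v'"
      by (rule fold_parameter)
    have "\<mu> x = \<mu> v" "\<mu> y = \<mu> v'" using xk yj by (auto simp: mu_period_int mu_reflect_int)
    then have "\<mu> v' = \<mu> v" using mu by simp
    then have "v' = v" by (rule mu_inj[OF v' v])
    note yj = yj[unfolded this]
    have not_same: "y \<noteq> x + of_int i * \<omega>" for i using no_shift[of x y i] xy x y by auto
    \<comment> \<open>At the endpoints 0 and \<open>\<omega> / 2\<close> reflected and shifted
      parameters differ by a multiple of \<omega>, so \<open>no_shift\<close> excludes both
      endpoints.\<close>
    have "v \<noteq> 0" using xk yj not_same[of "j - k"] by (auto simp: algebra_simps)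
    have "v \<noteq> \<omega> / 2"
      using xk yj not_same[of "j - k"] not_same[of "j - k - 1"] not_same[of "j - k + 1"]
      by (auto simp: algebra_simps)
    have "\<not> (x = v + of_int k * \<omega> \<and> y = v + of_int j * \<omega>)"
      "\<not> (x = of_int k * \<omega> - v \<and> y = of_int j * \<omega> - v)"
      using not_same[of "j - k"] by (auto simp: algebra_simps)
    then consider "x = v + of_int k * \<omega>" "y = of_int j * \<omega> - v" | "x = of_int k * \<omega> - v" "y = v + of_int j * \<omega>"
      using xk yj by blast
    then obtain a b k j where ab: "a \<in> {0..<of_nat n * \<omega>}" "\<gamma> a = p" "\<gamma> b = p"
      "a = v + of_int k * \<omega>" "b = of_int j * \<omega> - v"
      using x y by cases blast+
    have v': "0 < v" "v < \<omega> / 2" "v < \<omega>" using v \<open>v \<noteq> 0\<close> \<open>v \<noteq> \<omega> / 2\<close> omega_pos by auto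
    have "\<gamma> (of_int j * \<omega> - v) = \<gamma> (v + of_int k * \<omega>)" using ab by simp
    then have "\<exists>l::int. phi v = pi * of_int l / real n" unfolding reflect_eq_iff[OF nd] by blast
    then have "v \<in> crossing" using v' by (simp add: crossing_def)
    moreover have "0 \<le> k \<and> k < int n" using ab param_range(1)[OF v'(1,3)] by simp
    then have "nat k < n" "p = crossing_point (v, nat k)" using ab by (auto simp: crossing_point_def)
    ultimately show "p \<in> crossing_point ` (SIGMA s:crossing. {..<n})" by blast
  }
qed

text \<open>\<open>phi\<close> increases strictly from 0 to \<open>pi * (n - m) / n\<close> on
  \<open>{0..\<omega> / 2}\<close>, so the crossings correspond to the integers strictly between 0
  and \<open>n - m\<close>.\<close>

lemma finite_crossing:
  assumes pos: "4 * lam * \<xi> + 1 > 0"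
  shows "finite crossing" "card crossing = n - m - 1"
proof -
  have mid: "phi (\<omega> / 2) = pi * (real n - real m) / real n"
    using pos Psi_hat_eq m_less by (simp add: phi_mid Psi_hat_def beta_def field_simps)
  have mono: "phi s < phi t" if "s < t" for s t using phi_strict_mono[of s t] pos that by simp
  have "\<exists>s. 0 < s \<and> s < \<omega> / 2 \<and> phi s = pi * of_int l / real n" if l: "l \<in> {1..<int n - int m}" for l
  proof -
    have "real_of_int l < real n - real m" using l by (simp flip: of_int_less_iff)
    then have l': "0 < pi * of_int l / real n" "pi * of_int l / real n < phi (\<omega> / 2)"
      unfolding mid using l n_pos by (auto intro!: divide_strict_right_mono)
    then obtain s where s: "0 \<le> s" "s \<le> \<omega> / 2" "phi s = pi * of_int l / real n"
      using IVT'[of phi 0 "pi * of_int l / real n" "\<omega> / 2"] omega_pos cont_phi by auto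
    then have "s \<noteq> 0" "s \<noteq> \<omega> / 2" using l' by auto
    then show ?thesis using s by (intro exI[of _ s]) auto
  qed
  then obtain f where f: "\<And>l. l \<in> {1..<int n - int m} \<Longrightarrow> 0 < f l \<and> f l < \<omega> / 2 \<and> phi (f l) = pi * of_int l / real n"
    by metis
  have "crossing = f ` {1..<int n - int m}"
  proof (intro equalityI subsetI)
    fix s assume "s \<in> crossing"
    then obtain l :: int where s: "0 < s" "s < \<omega> / 2" and l: "phi s = pi * of_int l / real n"
      by (auto simp: crossing_def)
    have "0 < pi * of_int l / real n" "pi * of_int l / real n < pi * (real n - real m) / real n"
      using mono[OF s(1)] mono[OF s(2)] unfolding l mid by auto
    then have "0 < real_of_int l" "real_of_int l < real n - real m"
      using n_pos by (auto simp: zero_less_mult_iff zero_less_divide_iff divide_less_cancel)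
    then have L: "l \<in> {1..<int n - int m}" by auto
    have "s = f l" using f[OF L] l mono[of s "f l"] mono[of "f l" s] by (cases s "f l" rule: linorder_cases) auto
    then show "s \<in> f ` {1..<int n - int m}" using L by blast
  qed (use f in \<open>auto simp: crossing_def\<close>)
  moreover have "inj_on f {1..<int n - int m}"
  proof (rule inj_onI)
    fix k l assume "k \<in> {1..<int n - int m}" "l \<in> {1..<int n - int m}" "f k = f l"
    then have "pi * of_int k / real n = pi * of_int l / real n" using f by metis
    then show "k = l" using n_pos by simp
  qed
  ultimately show "finite crossing" "card crossing = n - m - 1"
    using m_less by (auto simp: card_image)
qed

lemma card_ordinary_double_points:
  assumes pos: "4 * lam * \<xi> + 1 > 0"
  shows "finite (ordinary_double_points \<gamma>)" "card (ordinary_double_points \<gamma>) = n * (n - m - 1)"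
  using inj_crossing_point finite_crossing[OF pos] pos
  by (auto simp: ordinary_double_points_eq[OF pos] card_image card_cartesian_product)

lemma many_self_intersections:
  assumes neg: "4 * lam * \<xi> + 1 < 0"
  shows "\<exists>F \<subseteq> self_intersection_points \<gamma>. finite F \<and> card F = n * m"
proof -
  have nd: "4 * lam * \<xi> + 1 \<noteq> 0" using neg by simp
  have mid: "phi (\<omega> / 2) = - (pi * real m / real n)"
    using neg Psi_hat_eq by (simp add: phi_mid Psi_hat_def beta_def)
  have lam: "lam < 0"
  proof (rule ccontr)
    assume "\<not> lam < 0"
    then have "0 \<le> lam * \<xi>" using xi_pos by simp
    then show False using neg by simp
  qed
  \<comment> \<open>\<open>Q\<close> is \<open>1 - 16 * lam^2 * \<xi>^2 < 0\<close> at
    \<open>- 2 * lam\<close> and equals 1 at \<open>2 * \<xi> - 2 * lam\<close>, so it has a root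
    beyond \<open>- 2 * lam\<close>.\<close>
  have "e1 lam \<xi> > - 2 * lam"
  proof (rule ccontr)
    assume "\<not> ?thesis"
    then have *: "e1 lam \<xi> \<le> - 2 * lam" by simp
    have "0 < (- (4 * lam * \<xi>) - 1) * (1 - 4 * lam * \<xi>)"
      using neg by (intro mult_pos_pos) auto
    then have "Q lam \<xi> (- 2 * lam) < 0"
      by (simp add: Q_eq algebra_simps power2_eq_square)
    moreover have "Q lam \<xi> (2 * \<xi> - 2 * lam) \<ge> 0" by (simp add: Q_eq algebra_simps power2_eq_square)
    moreover have "continuous_on {- 2 * lam..2 * \<xi> - 2 * lam} (Q lam \<xi>)"
      unfolding Q_def[abs_def] by (intro continuous_intros)
    ultimately obtain x where x: "- 2 * lam \<le> x" "Q lam \<xi> x = 0"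
      using IVT'[of "Q lam \<xi>" "- 2 * lam" 0 "2 * \<xi> - 2 * lam"] xi_pos by auto
    then have "x \<le> e1 lam \<xi>" using lam by (intro e1_max) auto
    then have "x = - 2 * lam" using * x by simp
    then show False using x(2) \<open>Q lam \<xi> (- 2 * lam) < 0\<close> by (simp only: less_irrefl)
  qed
  then have "\<mu> (\<omega> / 2) + 2 * lam > 0" by (simp add: mu_mid)
  moreover have "4 * \<xi>^2 * (\<mu> (\<omega> / 2))^2 - 1 > 0"
    using four_xi_mu_gt[of "\<omega> / 2"] two_xi_mu_gt[OF nd, of "\<omega> / 2"] by auto
  ultimately have "phi' (\<omega> / 2) > 0" using nd xi_pos by (simp add: phi'_def)
  then obtain d where d: "d > 0" "\<And>h. 0 < h \<Longrightarrow> h < d \<Longrightarrow> phi (\<omega> / 2 - h) < phi (\<omega> / 2)"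
    using DERIV_pos_inc_left[OF DERIV_phi] by blast
  \<comment> \<open>The distance to \<open>\<omega> / 2\<close> is below \<open>d\<close>, and the
    cap \<open>\<omega> / 4\<close> keeps \<open>b\<close> positive.\<close>
  define b where "b = \<omega> / 2 - min (d / 2) (\<omega> / 4)"
  have b: "0 < b" "b < \<omega> / 2" "phi b < - (pi * real m / real n)"
    using d omega_pos by (auto simp: b_def mid[symmetric] min_def intro!: d(2))
  have "\<exists>s. 0 < s \<and> s < \<omega> / 2 \<and> phi s = - (pi * real l / real n)" if l: "l \<in> {1..m}" for l
  proof -
    have "pi * real l / real n \<le> pi * real m / real n" using l by (intro divide_right_mono mult_left_mono) auto
    then have l': "phi b < - (pi * real l / real n)" "- (pi * real l / real n) < 0"
      using b l n_pos by auto
    then obtain s where s: "0 \<le> s" "s \<le> b" "phi s = - (pi * real l / real n)"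
      using IVT2'[of phi b "- (pi * real l / real n)" 0] b cont_phi by auto
    then have "s \<noteq> 0" using l' by auto
    then show ?thesis using s b by (intro exI[of _ s]) auto
  qed
  then obtain f where f: "\<And>l. l \<in> {1..m} \<Longrightarrow> 0 < f l \<and> f l < \<omega> / 2 \<and> phi (f l) = - (pi * real l / real n)"
    by metis
  have sub: "f ` {1..m} \<subseteq> crossing"
  proof clarify
    fix l assume "l \<in> {1..m}"
    then have "phi (f l) = pi * of_int (- int l) / real n" using f by simp
    then show "f l \<in> crossing" using f[OF \<open>l \<in> {1..m}\<close>] unfolding crossing_def by blast
  qed
  have "inj_on f {1..m}"
  proof (rule inj_onI)
    fix k l assume "k \<in> {1..m}" "l \<in> {1..m}" "f k = f l"
    then have "- (pi * real k / real n) = - (pi * real l / real n)" using f by metis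
    then show "k = l" using n_pos by simp
  qed
  then have "card (f ` {1..m}) = m" by (simp add: card_image)
  moreover have inj: "inj_on crossing_point (SIGMA s:f ` {1..m}. {..<n})"
    by (rule inj_on_subset[OF inj_crossing_point[OF nd]]) (use sub in auto)
  ultimately have "card (crossing_point ` (SIGMA s:f ` {1..m}. {..<n})) = n * m"
    by (simp add: card_image card_cartesian_product)
  moreover have "crossing_point ` (SIGMA s:f ` {1..m}. {..<n}) \<subseteq> self_intersection_points \<gamma>"
    using crossing_point_self_intersection[OF nd] sub by auto
  ultimately show ?thesis by (intro exI[of _ "crossing_point ` (SIGMA s:f ` {1..m}. {..<n})"]) auto
qed

section \<open>The axis and the linking number\<close>

lemma avoids_axis:
  assumes nd: "4 * lam * \<xi> + 1 \<noteq> 0"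
  shows "range \<gamma> \<inter> Ox_axis = {}"
proof -
  have "rho s \<noteq> 0" for s using rho_pos[OF nd, of s] by simp
  then show ?thesis by (auto simp: in_Ox_axis_iff proj_eq_0_iff)
qed

text \<open>The projection is \<open>exp\<close> of the explicit path \<open>g\<close>. Over a least
  period the radius returns to its value, so only the change \<open>- n * Psi\<close> of the angle
  contributes.\<close>

lemma linking_number:
  assumes nd: "4 * lam * \<xi> + 1 \<noteq> 0"
  shows "linking_number_Ox \<gamma> = of_real (- (real n * Psi lam \<xi> \<mu> \<omega>) / (2 * pi))"
proof -
  define g where "g t = Ln phase + of_real (ln (rho (of_nat n * \<omega> * t))) + \<i> * of_real (phi (of_nat n * \<omega> * t))" for t
  have cont_rho: "continuous_on A rho" for A
    by (intro continuous_at_imp_continuous_on ballI DERIV_isCont[OF DERIV_rho])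
  have "path g"
    unfolding path_def g_def[abs_def] using rho_pos[OF nd]
    by (intro continuous_intros continuous_on_compose2[OF cont_rho[of UNIV]]
        continuous_on_compose2[OF cont_phi[of UNIV]]) (auto simp: less_imp_neq[symmetric])
  moreover have "(\<lambda>t. proj_yz (\<gamma> (least_period \<gamma> * t))) = exp \<circ> g"
  proof
    fix t
    show "proj_yz (\<gamma> (least_period \<gamma> * t)) = (exp \<circ> g) t"
      using rho_pos[OF nd]
      by (simp add: least_period_gamma proj_gamma g_def exp_add cis_conv_exp exp_of_real)
  qed
  ultimately have "linking_number_Ox \<gamma> = (g 1 - g 0) / (2 * of_real pi * \<i>)"
    unfolding linking_number_Ox_def using winding_number_compose_exp[of g]
    by (simp add: pathfinish_def pathstart_def)
  also have "g 1 - g 0 = \<i> * of_real (- (real n * Psi lam \<xi> \<mu> \<omega>))"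
    using nd mu_period_int[of 0 "int n"] phi_period_nat[of 0 n]
    by (simp add: g_def rho_def sigma_nondeg)
  also have "\<dots> / (2 * of_real pi * \<i>) = of_real (- (real n * Psi lam \<xi> \<mu> \<omega>) / (2 * pi))"
    by (simp add: field_simps)
  finally show ?thesis .
qed

lemma linking_number_pos:
  assumes "4 * lam * \<xi> + 1 > 0"
  shows "linking_number_Ox \<gamma> = of_int (int n - int m)"
proof -
  have "- (real n * Psi lam \<xi> \<mu> \<omega>) / (2 * pi) = real n - real m"
    using assms Psi_hat_eq m_less by (simp add: Psi_hat_def beta_def field_simps)
  then show ?thesis using linking_number assms by simp
qed

lemma linking_number_neg:
  assumes "4 * lam * \<xi> + 1 < 0"
  shows "linking_number_Ox \<gamma> = of_int (- int m)"
proof -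
  have "- (real n * Psi lam \<xi> \<mu> \<omega>) / (2 * pi) = - real m"
    using assms Psi_hat_eq m_less by (simp add: Psi_hat_def beta_def field_simps)
  then show ?thesis using linking_number assms by simp
qed

lemma axis_parameters:
  assumes deg: "4 * lam * \<xi> + 1 = 0"
  shows "finite {s \<in> {0..<least_period \<gamma>}. \<gamma> s \<in> Ox_axis}"
    and "card {s \<in> {0..<least_period \<gamma>}. \<gamma> s \<in> Ox_axis} = n"
proof -
  have "{s \<in> {0..<least_period \<gamma>}. \<gamma> s \<in> Ox_axis} = (\<lambda>i. of_nat i * \<omega>) ` {..<n}"
  proof (intro equalityI subsetI)
    fix s assume "s \<in> {s \<in> {0..<least_period \<gamma>}. \<gamma> s \<in> Ox_axis}"
    then obtain k :: int where k: "s = of_int k * \<omega>" and s: "0 \<le> s" "s < of_nat n * \<omega>"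
      using deg by (auto simp: in_Ox_axis_iff proj_eq_0_iff rho_zero_iff two_xi_mu_eq_1_iff least_period_gamma)
    then have "0 \<le> k" "k < int n" using omega_pos by (auto simp: zero_le_mult_iff)
    then show "s \<in> (\<lambda>i. of_nat i * \<omega>) ` {..<n}" using k by (intro image_eqI[of _ _ "nat k"]) auto
  next
    fix s assume "s \<in> (\<lambda>i. of_nat i * \<omega>) ` {..<n}"
    then obtain i where i: "i < n" "s = of_int (int i) * \<omega>" by auto
    then show "s \<in> {s \<in> {0..<least_period \<gamma>}. \<gamma> s \<in> Ox_axis}"
      using deg omega_pos
      by (auto simp: in_Ox_axis_iff proj_eq_0_iff rho_zero_iff two_xi_mu_eq_1_iff least_period_gamma intro: exI[of _ "int i"])
  qed
  moreover have "inj_on (\<lambda>i. of_nat i * \<omega>) {..<n}"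
    using omega_pos by (intro inj_onI) simp
  ultimately show "finite {s \<in> {0..<least_period \<gamma>}. \<gamma> s \<in> Ox_axis}"
    "card {s \<in> {0..<least_period \<gamma>}. \<gamma> s \<in> Ox_axis} = n"
    by (simp_all add: card_image)
qed

section \<open>The turning number in the degenerate case\<close>

lemma proj_velocity_shift: "proj_yz (velocity \<gamma> (s + \<omega>)) = cis (- beta) * proj_yz (velocity \<gamma> s)"
proof -
  have "((\<lambda>s. proj_yz (\<gamma> (s + \<omega>))) has_vector_derivative proj_yz (velocity \<gamma> (s + \<omega>))) (at s)"
    using vector_diff_chain_at[of "\<lambda>s. s + \<omega>" 1 s, OF _ has_vector_derivative_proj]
    by (simp add: o_def has_vector_derivative_add_const)
  moreover have "((\<lambda>s. proj_yz (\<gamma> (s + \<omega>))) has_vector_derivative cis (- beta) * proj_yz (velocity \<gamma> s)) (at s)"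
    unfolding proj_period by (rule has_vector_derivative_mult_right[OF has_vector_derivative_proj])
  ultimately show ?thesis by (rule vector_derivative_unique_at)
qed

text \<open>Over one period of \<mu> the angle of the velocity gains
  \<open>phi \<omega> = pi - beta\<close> from the rotating frame and \<open>pi\<close> within it.
  The total \<open>2 * pi - beta\<close>, taken \<open>n\<close> times, is
  \<open>2 * pi * (n - m)\<close>.\<close>

lemma turning_number_degenerate:
  assumes deg: "4 * lam * \<xi> + 1 = 0"
  shows "turning_number (\<lambda>s. proj_yz (\<gamma> s)) = of_int (int n - int m)"
proof -
  define v where "v s = proj_yz (velocity \<gamma> s)" for s
  have v0: "v s \<noteq> 0" for s
    using polar_velocity_neq_0[of s] by (simp add: v_def proj_velocity)
  have cont_v: "continuous_on A v" for A
    unfolding v_def[abs_def]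
    by (rule bounded_linear.continuous_on[OF bounded_linear_proj_yz cont_velocity])
  \<comment> \<open>The velocity of the projection has no zero and the line is contractible, so a
    continuous logarithm exists.\<close>
  obtain L where L: "continuous_on UNIV L" "\<And>s. v s = exp (L s)"
    using continuous_logarithm_on_contractible[OF cont_v[of UNIV] contractible_UNIV] v0 by auto
  define \<Lambda> where "\<Lambda> s = Im (L s)" for s
  have cont_\<Lambda>: "continuous_on A \<Lambda>" for A
    unfolding \<Lambda>_def[abs_def] using L(1) by (intro continuous_intros) (rule continuous_on_subset, auto)
  have sgn_v: "sgn (v s) = cis (\<Lambda> s)" for s
    by (simp add: L(2) \<Lambda>_def sgn_eq exp_eq_polar[of "L s"] norm_mult)
  \<comment> \<open>A shift by \<omega> rotates the velocity by a constant angle, so both lifts have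
    the same increments.\<close>
  have "\<Lambda> (s + \<omega>) - \<Lambda> (0 + \<omega>) = \<Lambda> s - \<Lambda> 0" for s
  proof (rule cis_lift_unique[of UNIV "\<lambda>s. \<Lambda> (s + \<omega>)" \<Lambda> "cis (- beta)"])
    show "cis (\<Lambda> (s + \<omega>)) = cis (- beta) * cis (\<Lambda> s)" for s
      by (simp add: v_def proj_velocity_shift sgn_mult flip: sgn_v)
  qed (auto intro!: cont_\<Lambda> continuous_on_compose2[OF cont_\<Lambda>[of UNIV]] continuous_intros)
  then have step: "\<Lambda> (s + \<omega>) - \<Lambda> \<omega> = \<Lambda> s - \<Lambda> 0" for s by simp
  have total: "\<Lambda> (of_nat k * \<omega>) = \<Lambda> 0 + of_nat k * (\<Lambda> \<omega> - \<Lambda> 0)" for k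
  proof (induction k)
    case (Suc k)
    have "\<Lambda> (of_nat (Suc k) * \<omega>) = \<Lambda> (of_nat k * \<omega> + \<omega>)" by (simp add: algebra_simps)
    then show ?case using step[of "of_nat k * \<omega>"] Suc by (simp add: algebra_simps)
  qed simp
  text \<open>
    On one period of \<open>\<mu>\<close> the signed radius is nonnegative, so the velocity in the rotating frame
    stays in the closed upper half plane, where its argument is an arc cosine.
  \<close>
  define A where "A s = arccos (Re (sgn (polar_velocity s)))" for s
  have rho_0: "rho 0 = 0" "rho \<omega> = 0"
    using mu_0_degenerate[OF deg] mu_period[of 0] by (simp_all add: rho_zero_iff)
  have Re_bound: "- 1 \<le> Re (sgn z) \<and> Re (sgn z) \<le> 1" for z :: complex
  proof -
    have "\<bar>Re (sgn z)\<bar> \<le> 1" using abs_Re_le_cmod[of "sgn z"] by (rule order_trans) (simp add: norm_sgn)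
    then show ?thesis by linarith
  qed
  have cont_pv: "continuous_on B polar_velocity" for B
    unfolding polar_velocity_def[abs_def] using cont_v[of B] unfolding v_def
    by (intro continuous_intros cont_phi) auto
  have cont_A: "continuous_on {0..\<omega>} A"
    unfolding A_def[abs_def] using polar_velocity_neq_0 Re_bound
    by (intro continuous_on_arccos continuous_intros cont_pv) auto
  have cis_A: "cis (A s) = sgn (polar_velocity s)" if "s \<in> {0..\<omega>}" for s
  proof -
    let ?z = "sgn (polar_velocity s)"
    have "rho s \<ge> 0" using that rho_nonneg[of s] rho_0 by (cases "s = \<omega>") auto
    then have "Im (polar_velocity s) \<ge> 0" using phi'_pos[of s] deg by (simp add: Im_polar_velocity)
    then have im: "Im ?z \<ge> 0" by (simp add: sgn_eq)
    have "(Re ?z)\<^sup>2 + (Im ?z)\<^sup>2 = 1"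
      unfolding cmod_power2[symmetric] using polar_velocity_neq_0[of s] by (simp only: norm_sgn) simp
    then have "sqrt (1 - (Re ?z)\<^sup>2) = Im ?z" using im by (intro real_sqrt_unique) auto
    then show ?thesis using Re_bound[of "polar_velocity s"]
      by (simp add: A_def complex_eq_iff sin_arccos)
  qed
  have "\<Lambda> \<omega> - \<Lambda> 0 = (phi \<omega> + A \<omega>) - (phi 0 + A 0)"
  proof (rule cis_lift_unique[of "{0..\<omega>}" \<Lambda> "\<lambda>s. phi s + A s" phase])
    fix s assume "s \<in> {0..\<omega>}"
    have "cis (\<Lambda> s) = sgn (phase * polar_velocity s * cis (phi s))"
      by (simp add: v_def proj_velocity flip: sgn_v)
    also have "\<dots> = phase * sgn (polar_velocity s) * cis (phi s)"
      by (simp add: sgn_mult sgn_eq[of phase] sgn_eq[of "cis _"])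
    also have "\<dots> = phase * cis (phi s + A s)"
      by (simp add: cis_A[OF \<open>s \<in> {0..\<omega>}\<close>, symmetric] cis_mult add.commute)
    finally show "cis (\<Lambda> s) = phase * cis (phi s + A s)" .
  qed (use omega_pos in \<open>auto intro!: cont_\<Lambda> cont_phi cont_A continuous_intros\<close>)
  \<comment> \<open>\<open>rho\<close> is nonnegative after its zero at 0, so on leaving the axis
    the velocity in the rotating frame is a positive real.\<close>
  moreover have "A 0 = 0"
  proof -
    have im: "Im (polar_velocity 0) = 0" by (simp add: Im_polar_velocity rho_0)
    have "\<not> Re (polar_velocity 0) < 0"
    proof
      assume "Re (polar_velocity 0) < 0"
      then obtain d where d: "d > 0" "\<And>h. 0 < h \<Longrightarrow> h < d \<Longrightarrow> rho (0 + h) < rho 0"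
        using DERIV_neg_dec_right[OF DERIV_rho] by blast
      have "rho (0 + min (d / 2) (\<omega> / 2)) < rho 0" using d(1) omega_pos by (intro d(2)) auto
      moreover have "rho (min (d / 2) (\<omega> / 2)) \<ge> 0" using d(1) omega_pos by (intro rho_nonneg) auto
      ultimately show False using rho_0 by simp
    qed
    then have "Re (polar_velocity 0) > 0"
      using polar_velocity_neq_0[of 0] im by (simp add: complex_eq_iff)
    then have "sgn (polar_velocity 0) = 1" using im by (simp add: sgn_eq complex_eq_iff cmod_def)
    then show ?thesis by (simp add: A_def)
  qed
  \<comment> \<open>\<open>rho\<close> is nonnegative before its zero at \<omega>, so on return to
    the axis that velocity is a negative real.\<close>
  moreover have "A \<omega> = pi"
  proof -
    have im: "Im (polar_velocity \<omega>) = 0" by (simp add: Im_polar_velocity rho_0)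
    have "\<not> Re (polar_velocity \<omega>) > 0"
    proof
      assume "Re (polar_velocity \<omega>) > 0"
      then obtain d where d: "d > 0" "\<And>h. 0 < h \<Longrightarrow> h < d \<Longrightarrow> rho (\<omega> - h) < rho \<omega>"
        using DERIV_pos_inc_left[OF DERIV_rho] by blast
      have "rho (\<omega> - min (d / 2) (\<omega> / 2)) < rho \<omega>" using d(1) omega_pos by (intro d(2)) auto
      moreover have "rho (\<omega> - min (d / 2) (\<omega> / 2)) \<ge> 0" using d(1) omega_pos by (intro rho_nonneg) auto
      ultimately show False using rho_0 by simp
    qed
    then have "Re (polar_velocity \<omega>) < 0"
      using polar_velocity_neq_0[of \<omega>] im by (simp add: complex_eq_iff)
    then have "sgn (polar_velocity \<omega>) = - 1" using im by (simp add: sgn_eq complex_eq_iff cmod_def)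
    then show ?thesis by (simp add: A_def)
  qed
  moreover have "phi \<omega> = pi - beta"
    using phi_period[of 0] Psi_hat_eq deg by (simp add: Psi_hat_def)
  ultimately have "\<Lambda> \<omega> - \<Lambda> 0 = 2 * pi - beta" by simp
  then have winding: "\<Lambda> (of_nat n * \<omega>) - \<Lambda> 0 = 2 * pi * (real n - real m)"
    using total[of n] m_less by (simp add: beta_def field_simps)
  define g where "g t = \<i> * of_real (\<Lambda> (of_nat n * \<omega> * t))" for t
  have "path g"
    unfolding path_def g_def[abs_def]
    by (intro continuous_intros continuous_on_compose2[OF cont_\<Lambda>[of UNIV]]) auto
  moreover have "velocity (\<lambda>s. proj_yz (\<gamma> s)) s = v s" for s
    unfolding velocity_def v_def
    using vector_derivative_at[OF has_vector_derivative_proj] by (simp add: velocity_def)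
  then have "(\<lambda>t. sgn (velocity (\<lambda>s. proj_yz (\<gamma> s)) (least_period (\<lambda>s. proj_yz (\<gamma> s)) * t))) = exp \<circ> g"
    by (auto simp: least_period_proj sgn_v g_def cis_conv_exp)
  ultimately have "turning_number (\<lambda>s. proj_yz (\<gamma> s)) = (g 1 - g 0) / (2 * of_real pi * \<i>)"
    unfolding turning_number_def using winding_number_compose_exp[of g]
    by (simp add: pathfinish_def pathstart_def)
  also have "g 1 - g 0 = \<i> * of_real (\<Lambda> (of_nat n * \<omega>) - \<Lambda> 0)"
    by (simp add: g_def algebra_simps)
  also have "\<dots> / (2 * of_real pi * \<i>) = of_int (int n - int m)"
    unfolding winding by simp
  finally show ?thesis .
qed

end

theorem theorem1p3:
  fixes lam \<xi> \<omega> :: real and \<mu> :: "real \<Rightarrow> real" and \<gamma> :: "real \<Rightarrow> real^3" and m n :: nat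
  assumes "\<xi> > 0" and "\<xi> > eta_hat lam"
    and "normalized_solution lam \<xi> \<mu> \<omega>"
    and "\<gamma> = std_curve lam \<xi> \<mu> \<omega>"
    and "B_string lam \<gamma>"
    and "characteristic_number lam \<xi> \<mu> \<omega> m n"
  shows
    "((\<forall>A \<in> generated_group {rot_Ox (2 * pi / real n)}. (\<lambda>p. A *v p) ` range \<gamma> = range \<gamma>) \<and>
      (\<exists>c1 c2. 0 < c1 \<and> c1 < c2 \<and> c2 \<le> 1 \<and>
         range \<gamma> \<subseteq> {p \<in> upper_hemisphere. c1 \<le> p$1 \<and> p$1 \<le> c2})) \<and>
     (4 * lam * \<xi> + 1 \<noteq> 0 \<longrightarrow> range \<gamma> \<inter> Ox_axis = {}) \<and>
     (4 * lam * \<xi> + 1 > 0 \<longrightarrow>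
        linking_number_Ox \<gamma> = of_int (int n - int m) \<and>
        finite (ordinary_double_points \<gamma>) \<and>
        card (ordinary_double_points \<gamma>) = n * (n - m - 1)) \<and>
     (4 * lam * \<xi> + 1 < 0 \<longrightarrow>
        linking_number_Ox \<gamma> = of_int (- int m) \<and>
        (\<exists>F \<subseteq> self_intersection_points \<gamma>. finite F \<and> card F = n * m)) \<and>
     (4 * lam * \<xi> + 1 = 0 \<longrightarrow>
        lam < 0 \<and>
        finite {s \<in> {0..<least_period \<gamma>}. \<gamma> s \<in> Ox_axis} \<and>
        card {s \<in> {0..<least_period \<gamma>}. \<gamma> s \<in> Ox_axis} = n \<and>
        (\<forall>s. \<gamma> s \<notin> Ox_axis \<longrightarrow> \<gamma> s $ 2 * velocity \<gamma> s $ 3 - \<gamma> s $ 3 * velocity \<gamma> s $ 2 > 0) \<and>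
        turning_number (\<lambda>s. proj_yz (\<gamma> s)) = of_int (int n - int m))"
proof -
  interpret characteristic_B_string lam \<xi> \<omega> \<mu> \<gamma> m n
    using assms by unfold_locales
  have "lam < 0" if "4 * lam * \<xi> + 1 = 0"
  proof (rule ccontr)
    assume "\<not> lam < 0"
    then have "0 \<le> lam * \<xi>" using assms(1) by simp
    then show False using that by simp
  qed
  moreover have "\<gamma> s $ 2 * velocity \<gamma> s $ 3 - \<gamma> s $ 3 * velocity \<gamma> s $ 2 > 0"
    if "4 * lam * \<xi> + 1 = 0" "\<gamma> s \<notin> Ox_axis" for s
    using that phi'_pos[of s] by (simp add: angular_momentum in_Ox_axis_iff proj_eq_0_iff)
  ultimately show ?thesis
    by (intro conjI impI ballI allI range_invariant range_between_planes avoids_axis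
        linking_number_pos card_ordinary_double_points linking_number_neg many_self_intersections
        axis_parameters turning_number_degenerate)
qed

end
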